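(* Let $r$ and $s$ be integers greater than $1$ that are not multiplicatively dependent (i.e. $r$ and $s$ are not rational powers of each other). Let $K,l$ be positive integers such that $l\ge s^K$ and denote $m=\max(r,s)$. Then for every integer $$N\ge N_0(r,s)=\exp\bigl(288\cdot(12m(\log m)^4+8(\log m)^3+(\log m)^2)\bigr)$$ we have $$\sum_{n=0}^{N-1}\prod_{k=K+1}^{\infty}\left|\cos(\pi r^n l/s^k)\right|\le 2N^{1-a_{20}},$$ where $a_{20}$ is the positive constant $$a_{20}=\frac16\cdot\frac{\pi^2}{2}\cdot 0.007\cdot\frac{1}{s^4}\cdot\frac{1}{\log s}\left(\frac{1}{\log s}-\frac1s\right)\approx 0.0057\cdot\frac{1}{s^4\log s}\left(\frac1{\log s}-\frac1s\right).$$
   Context: $\log$ denotes the natural logarithm. *)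

theory Defs
  imports "HOL-Analysis.Analysis"
begin

definition mult_dependent :: "nat \<Rightarrow> nat \<Rightarrow> bool" where
  "mult_dependent r s \<longleftrightarrow>
     (\<exists>q\<in>\<rat>. real r = real s powr q \<or> real s = real r powr q)"

definition N0 :: "nat \<Rightarrow> nat \<Rightarrow> real" where
  "N0 r s = (let m = real (max r s) in
     exp (288 * (12 * m * (ln m) ^ 4 + 8 * (ln m) ^ 3 + (ln m) ^ 2)))"

definition a20 :: "nat \<Rightarrow> real" where
  "a20 s = 1 / 6 * (pi\<^sup>2 / 2) * (7 / 1000) * (1 / real s ^ 4) * (1 / ln (real s))
             * (1 / ln (real s) - 1 / real s)"

lemma a20_pos:
  assumes "s > 1"
  shows "a20 s > 0"
proof -
  have l: "ln (real s) > 0" and "ln (real s) < real s"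
    using assms ln_less_self[of "real s"] by simp_all
  then have "1 / real s < 1 / ln (real s)"
    by (simp add: frac_less2)
  with l assms show ?thesis
    unfolding a20_def by (intro mult_pos_pos) simp_all
qed

text \<open>
  The index \<open>j\<close> corresponds to \<open>k = K + 1 + j\<close>. Finitely many factors may vanish; the
  library's notion of convergence of an infinite product allows this, and the product is then 0.
\<close>

definition cos_prod :: "nat \<Rightarrow> nat \<Rightarrow> nat \<Rightarrow> nat \<Rightarrow> nat \<Rightarrow> real" where
  "cos_prod r s K l n = (\<Prod>j. \<bar>cos (pi * real r ^ n * real l / real s ^ (K + 1 + j))\<bar>)"

lemma convergent_cos_prod:
  assumes "s > 1"
  shows "convergent_prod (\<lambda>j. \<bar>cos (pi * real r ^ n * real l / real s ^ (K + 1 + j))\<bar>)"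
proof -
  define c where "c = pi * real r ^ n * real l / real s ^ (K + 1)"
  have c: "pi * real r ^ n * real l / real s ^ (K + 1 + j) = c * (1 / real s) ^ j" for j
    by (simp add: c_def power_add power_one_over field_simps)
  have bound: "norm (\<bar>cos x\<bar> - 1) \<le> \<bar>x\<bar>" for x :: real
  proof -
    have "(cos x)\<^sup>2 \<le> \<bar>cos x\<bar>"
      using mult_left_le[of "\<bar>cos x\<bar>" "\<bar>cos x\<bar>"] by (simp add: power2_eq_square)
    then have "1 - \<bar>cos x\<bar> \<le> (sin x)\<^sup>2"
      by (simp add: sin_squared_eq)
    also have "\<dots> \<le> \<bar>sin x\<bar>"
      using mult_left_le[of "\<bar>sin x\<bar>" "\<bar>sin x\<bar>"] by (simp add: power2_eq_square)
    also have "\<dots> \<le> \<bar>x\<bar>"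
      by (rule abs_sin_x_le_abs_x)
    finally show ?thesis
      by simp
  qed
  have "summable (\<lambda>j. \<bar>c\<bar> * (1 / real s) ^ j)"
    using assms by (intro summable_mult summable_geometric) simp
  then have "summable (\<lambda>j. norm (\<bar>cos (c * (1 / real s) ^ j)\<bar> - 1))"
    by (rule summable_comparison_test'[where N = 0])
       (use bound[of "c * (1 / real s) ^ j" for j] in \<open>simp add: abs_mult power_abs\<close>)
  then have "abs_convergent_prod (\<lambda>j. \<bar>cos (c * (1 / real s) ^ j)\<bar>)"
    by (simp add: abs_convergent_prod_conv_summable)
  then show ?thesis
    unfolding c by (rule abs_convergent_prod_imp_convergent_prod)
qed

end

theory Submission
  imports Defs "HOL-Number_Theory.Residues"
begin

text \<open>
  Write \<open>Y\<close> for \<open>l * r ^ n\<close>. If the base-\<open>s\<close> digits of \<open>Y\<close> in two adjacent positions \<open>\<ge> K\<close>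
  are neither both \<open>0\<close> nor both \<open>s - 1\<close>, then for the matching \<open>k\<close> the number \<open>Y / s ^ k\<close> is at
  distance at least \<open>1 / s\<^sup>2\<close> from the integers and the factor \<open>\<bar>cos (pi * Y / s ^ k)\<bar>\<close> is at most
  \<open>cos (pi / s\<^sup>2) \<le> exp (- pi\<^sup>2 / (2 * s ^ 4))\<close>. Call such a pair of digits mixed. The constant
  \<open>a20 s\<close> is \<open>pi\<^sup>2 / (2 * s ^ 4)\<close> times \<open>mixed_density s\<close>, so every \<open>n\<close> with at least
  \<open>mixed_density s * ln N\<close> mixed pairs contributes at most \<open>N powr (- a20 s)\<close>. It remains to see
  that at most \<open>N powr (13 / 20)\<close> indices \<open>n < N\<close> have no more mixed pairs than that.

  The digits of \<open>l * r ^ n\<close> above position \<open>K\<close> are, in effect, those of \<open>x * r ^ n\<close> with an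
  arbitrary real \<open>x \<ge> 1\<close>, so congruences for \<open>l * r ^ n\<close> say nothing about them directly. They
  become available after one step. Cut \<open>{..<N}\<close> into blocks of length \<open>H\<close>, about \<open>sqrt N\<close>,
  and let \<open>n0\<close> be the first index of a block with few mixed pairs. Unless \<open>n0\<close> is one of the
  smallest indices, which can be discarded, the number \<open>(l * r ^ n0) div s ^ K\<close> has far more than
  \<open>H * ln N\<close> digits, so some long run of positions contains no mixed pair, which means that
  \<open>l * r ^ n0\<close> is very close to a multiple \<open>u * s ^ E\<close> of a power of \<open>s\<close>. Multiplying by \<open>r ^ h\<close> with \<open>h < H\<close> does not spoil this: the digits
  of \<open>l * r ^ (n0 + h)\<close> from position \<open>E\<close> on are those of \<open>u * r ^ h\<close> or of \<open>u * r ^ h - 1\<close>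
  (\<open>card_few_mixed_block\<close>). Thus it suffices to count the \<open>h < H\<close> for which the integer
  \<open>u * r ^ h\<close>, or its predecessor, has few mixed pairs.

  This count is arithmetic (\<open>card_few_mixed_orbit\<close>). Strip the factors \<open>s\<close>, writing
  \<open>u * r ^ h = s ^ t * M\<close> with \<open>\<not> s dvd M\<close>, and choose a prime \<open>p\<close> at which \<open>M\<close> has smaller
  valuation than \<open>s\<close>. If two exponents with the same \<open>p\<close> lead to the same \<open>M\<close> modulo \<open>s ^ q\<close>,
  then a high power of \<open>p\<close> divides \<open>a ^ g - b ^ g\<close>, where \<open>g\<close> is the difference of the exponents
  and \<open>a\<close>, \<open>b\<close> are the \<open>p\<close>-free parts of \<open>r ^ d\<close> and \<open>s ^ e\<close>, for \<open>d\<close> and \<open>e\<close> the \<open>p\<close>-valuations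
  of \<open>s\<close> and \<open>r\<close>. These are different because \<open>r\<close> and \<open>s\<close> are multiplicatively independent, and
  lifting the exponent bounds the power of \<open>p\<close>. With \<open>q\<close> about \<open>2 * ln N\<close> this is
  impossible (\<open>orbit_residue_gap\<close>), so for each \<open>p\<close> the exponent \<open>h\<close> is determined by the residue
  of \<open>M\<close> modulo \<open>s ^ q\<close>, and the residues with few mixed pairs are rare (\<open>card_few_mixed_residues\<close>).
\<close>

section \<open>Lifting the exponent\<close>

lemma sum_powers_cong:
  fixes a b p :: int
  assumes "p dvd a - b"
  shows "[(\<Sum>i<Suc n. a ^ i * b ^ (n - i)) = int (Suc n) * b ^ n] (mod p)"
proof -
  have "[a = b] (mod p)"
    using assms by (simp add: cong_iff_dvd_diff)
  then have "[a ^ i * b ^ (n - i) = b ^ i * b ^ (n - i)] (mod p)" for i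
    by (intro cong_mult cong_pow cong_refl)
  then have "[(\<Sum>i<Suc n. a ^ i * b ^ (n - i)) = (\<Sum>i<Suc n. b ^ i * b ^ (n - i))] (mod p)"
    by (intro cong_sum)
  also have "(\<Sum>i<Suc n. b ^ i * b ^ (n - i)) = (\<Sum>i<Suc n. b ^ n)"
    by (intro sum.cong) (simp_all flip: power_add)
  also have "\<dots> = int (Suc n) * b ^ n"
    by (simp add: algebra_simps)
  finally show ?thesis .
qed

text \<open>
  Consequently the cofactor \<open>(a ^ p - b ^ p) / (a - b)\<close> is divisible by \<open>p\<close> exactly once when \<open>b\<close> is
  prime to \<open>p\<close>. For odd \<open>p\<close> the
  first-order terms of the expansion around \<open>b\<close> add up to a multiple of \<open>p * (p - 1) / 2\<close>, hence
  of \<open>p\<close>; for \<open>p = 2\<close> this fails, which is why the stronger congruence modulo \<open>4\<close> is assumed.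
\<close>

lemma sum_powers_prime_cong:
  fixes a b :: int and p :: nat
  assumes p: "prime p" and ab: "int p dvd a - b" and four: "p = 2 \<Longrightarrow> 4 dvd a - b"
  shows "[(\<Sum>i<p. a ^ i * b ^ (p - 1 - i)) = int p * b ^ (p - 1)] (mod (int p)\<^sup>2)"
proof (cases "p = 2")
  case True
  then have "(\<Sum>i<p. a ^ i * b ^ (p - 1 - i)) - int p * b ^ (p - 1) = a - b"
    by (simp add: numeral_2_eq_2)
  with four True show ?thesis
    by (simp add: cong_iff_dvd_diff)
next
  case False
  with p have "odd p"
    using prime_odd_nat[of p] prime_ge_2_nat[of p] by linarith
  then obtain c where c: "p = 2 * c + 1"
    by (elim oddE)
  define T where "T i = (\<Sum>j<i. a ^ j * b ^ (i - 1 - j))" for i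
  have T: "a ^ i - b ^ i = (a - b) * T i" for i
    by (simp add: T_def power_diff_sumr2 mult.commute)
  have T_cong: "[T i * b ^ (p - 1 - i) = int i * b ^ (p - 2)] (mod int p)" if "i < p" for i
  proof (cases i)
    case (Suc j)
    have "[T i * b ^ (p - 1 - i) = (int i * b ^ j) * b ^ (p - 1 - i)] (mod int p)"
      using sum_powers_cong[OF ab, of j] by (intro cong_mult cong_refl) (simp add: T_def Suc)
    moreover have "b ^ j * b ^ (p - 1 - i) = b ^ (p - 2)"
      using that Suc by (auto simp flip: power_add)
    ultimately show ?thesis
      by (simp add: mult.assoc)
  qed (simp add: T_def)
  have "[(\<Sum>i<p. T i * b ^ (p - 1 - i)) = (\<Sum>i<p. int i * b ^ (p - 2))] (mod int p)"
    using T_cong by (intro cong_sum) auto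
  also have "(\<Sum>i<p. int i * b ^ (p - 2)) = int (\<Sum>i<p. i) * b ^ (p - 2)"
    by (simp add: sum_distrib_right)
  also have "(\<Sum>i<p. i) = p * c"
  proof -
    have "2 * (\<Sum>i<p. i) = 2 * (p * c)"
      using Sum_Ico_nat[of 0 p] c by (simp add: atLeast0LessThan)
    then show ?thesis by simp
  qed
  finally have "int p dvd (\<Sum>i<p. T i * b ^ (p - 1 - i))"
    by (simp add: cong_dvd_iff mult.assoc)
  then have "int p * int p dvd (a - b) * (\<Sum>i<p. T i * b ^ (p - 1 - i))"
    using ab by (rule mult_dvd_mono[rotated])
  also have "(a - b) * (\<Sum>i<p. T i * b ^ (p - 1 - i))
      = (\<Sum>i<p. (a ^ i - b ^ i) * b ^ (p - 1 - i))"
    by (simp add: T sum_distrib_left mult.assoc)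
  also have "\<dots> = (\<Sum>i<p. a ^ i * b ^ (p - 1 - i)) - (\<Sum>i<p. b ^ (p - 1))"
  proof -
    have "(a ^ i - b ^ i) * b ^ (p - 1 - i) = a ^ i * b ^ (p - 1 - i) - b ^ (p - 1)"
      if "i < p" for i
      using that by (simp add: left_diff_distrib flip: power_add)
    then show ?thesis
      by (subst sum_subtractf[symmetric]) (intro sum.cong; auto)
  qed
  finally show ?thesis
    by (simp add: cong_iff_dvd_diff power2_eq_square)
qed

text \<open>
  Raising to a power prime to \<open>p\<close> does not change the valuation of the difference and raising to
  the power \<open>p\<close> increases it by one, so the valuation of \<open>a ^ h - b ^ h\<close> exceeds that of \<open>a - b\<close>
  by at most that of \<open>h\<close>.
\<close>

lemma prime_power_dvd_power_diff:
  fixes a b :: int and p Q h :: nat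
  assumes p: "prime p" and b: "\<not> int p dvd b"
    and ab: "int p dvd a - b" and four: "p = 2 \<Longrightarrow> 4 dvd a - b"
    and "h > 0" and "int p ^ Q dvd a ^ h - b ^ h"
  shows "int p ^ Q dvd (a - b) * int h"
  using assms(5,6)
proof (induction h arbitrary: Q rule: less_induct)
  case (less h)
  have pint: "prime (int p)"
    using p by simp
  have split: "x ^ n - y ^ n = (x - y) * (\<Sum>i<n. x ^ i * y ^ (n - 1 - i))"
    for x y :: int and n
    by (simp add: power_diff_sumr2 mult.commute)
  have cop: "coprime (int p ^ Q') y" if "\<not> int p dvd y" for y Q'
    using that pint by (simp add: prime_imp_coprime)
  show ?case
  proof (cases "p dvd h")
    case False
    obtain n where n: "h = Suc n"
      using less.prems by (cases h) auto
    let ?S = "\<Sum>i<h. a ^ i * b ^ (h - 1 - i)"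
    have "[?S = int h * b ^ n] (mod int p)"
      using sum_powers_cong[OF ab, of n] by (simp add: n)
    moreover have "\<not> int p dvd int h * b ^ n"
      using False b prime_dvd_power[OF pint, of b n] prime_dvd_multD[OF pint, of "int h" "b ^ n"]
      by auto
    ultimately have "\<not> int p dvd ?S"
      by (simp add: cong_dvd_iff)
    moreover have "int p ^ Q dvd (a - b) * ?S"
      using less.prems split[of a h b] by simp
    ultimately have "int p ^ Q dvd a - b"
      using cop coprime_dvd_mult_left_iff by blast
    then show ?thesis by simp
  next
    case True
    then obtain g where g: "h = p * g" by blast
    have g0: "g > 0" and gh: "g < h"
      using less.prems g prime_gt_1_nat[OF p] by auto
    define A B where "A = a ^ g" and "B = b ^ g"
    have dvd: "a - b dvd A - B"
      unfolding A_def B_def using split[of a g b] by simp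
    have B: "\<not> int p dvd B"
      unfolding B_def using b prime_dvd_power[OF pint] by blast
    let ?S = "\<Sum>i<p. A ^ i * B ^ (p - 1 - i)"
    have "[?S = int p * B ^ (p - 1)] (mod (int p)\<^sup>2)"
      using dvd ab four by (intro sum_powers_prime_cong p) (auto intro: dvd_trans)
    then obtain k where k: "?S - int p * B ^ (p - 1) = (int p)\<^sup>2 * k"
      unfolding cong_iff_dvd_diff by (elim dvdE)
    define S' where "S' = B ^ (p - 1) + int p * k"
    have S: "?S = int p * S'"
      using k by (simp add: S'_def power2_eq_square algebra_simps)
    have "\<not> int p dvd S'"
      using B prime_dvd_power[OF pint] by (auto simp: S'_def dvd_add_left_iff)
    moreover have "int p ^ Q dvd ((A - B) * int p) * S'"
    proof -
      have "a ^ h - b ^ h = A ^ p - B ^ p"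
        by (simp add: A_def B_def g power_mult mult.commute[of p])
      also have "\<dots> = (A - B) * ?S"
        by (rule split)
      finally show ?thesis
        using less.prems S by (simp add: mult.assoc)
    qed
    ultimately have *: "int p ^ Q dvd (A - B) * int p"
      using cop coprime_dvd_mult_left_iff by blast
    show ?thesis
    proof (cases Q)
      case (Suc R)
      with * have "int p ^ R dvd A - B"
        using prime_gt_0_nat[OF p] by (simp add: mult.commute)
      then have "int p ^ R dvd (a - b) * int g"
        unfolding A_def B_def by (intro less.IH[OF gh g0])
      then have "int p ^ R * int p dvd ((a - b) * int g) * int p"
        by (rule mult_dvd_mono) simp
      then show ?thesis
        by (simp add: Suc g algebra_simps)
    qed simp
  qed
qed

text \<open>
  The exponent \<open>2 * (p - 1)\<close> brings both bases to \<open>1\<close> modulo \<open>p\<close> by Fermat's theorem, and modulo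
  \<open>4\<close> if \<open>p = 2\<close>. The more obvious exponent \<open>p * (p - 1)\<close>, which works modulo \<open>p\<^sup>2\<close> for every \<open>p\<close>,
  would make the logarithm of the bound quadratic in \<open>p\<close>, too large to be absorbed by \<open>N0\<close>.
\<close>

lemma prime_power_dvd_power_diff_bound:
  fixes p x y h q :: nat
  assumes p: "prime p" and x: "\<not> p dvd x" and y: "\<not> p dvd y" and "x \<noteq> y" and "h > 0"
    and dvd: "int p ^ q dvd int x ^ h - int y ^ h"
  shows "2 ^ q \<le> max x y ^ (2 * (p - 1)) * h"
proof -
  define k where "k = 2 * (p - 1)"
  define a b where "a = int x ^ k" and "b = int y ^ k"
  have p2: "p \<ge> 2"
    using p by (rule prime_ge_2_nat)
  have k0: "k > 0"
    using p2 by (simp add: k_def)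
  have one: "[z ^ k = 1] (mod p)" if "\<not> p dvd z" for z
  proof -
    have "[(z ^ (p - 1)) ^ 2 = 1 ^ 2] (mod p)"
      using that p by (intro cong_pow fermat_theorem)
    then show ?thesis
      by (simp add: k_def power_mult mult.commute[of 2])
  qed
  have "[x ^ k = y ^ k] (mod p)"
    using one[OF x] one[OF y] by (metis cong_sym cong_trans)
  then have ab: "int p dvd a - b"
    unfolding a_def b_def by (simp add: cong_iff_dvd_diff flip: cong_int_iff)
  have four: "4 dvd a - b" if "p = 2"
  proof -
    have "[int z ^ k = 1] (mod 4)" if "odd z" for z
    proof -
      obtain c where c: "z = 2 * c + 1"
        using \<open>odd z\<close> by (elim oddE)
      have "int z ^ k - 1 = 4 * (int c * int c + int c)"
        using \<open>p = 2\<close> by (simp add: k_def c power2_eq_square algebra_simps)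
      then show ?thesis
        by (simp add: cong_iff_dvd_diff)
    qed
    then have "[a = b] (mod 4)"
      unfolding a_def b_def using x y that by (meson cong_sym cong_trans)
    then show ?thesis
      by (simp add: cong_iff_dvd_diff)
  qed
  have "int p ^ q dvd a ^ h - b ^ h"
  proof -
    have "a ^ h - b ^ h = (int x ^ h) ^ k - (int y ^ h) ^ k"
      by (simp add: a_def b_def mult.commute flip: power_mult)
    then show ?thesis
      using dvd by (simp add: power_diff_sumr2)
  qed
  moreover have "\<not> int p dvd b"
    unfolding b_def using y prime_dvd_power[of "int p" "int y" k] p by auto
  ultimately have "int p ^ q dvd (a - b) * int h"
    using p ab four \<open>h > 0\<close> by (intro prime_power_dvd_power_diff)
  moreover have "a \<noteq> b"
    using \<open>x \<noteq> y\<close> k0 unfolding a_def b_def by (simp add: power_eq_iff_eq_base)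
  ultimately have "int p ^ q \<le> \<bar>(a - b) * int h\<bar>"
    using \<open>h > 0\<close> dvd_imp_le_int[of "(a - b) * int h" "int p ^ q"] by simp
  also have "\<dots> = \<bar>a - b\<bar> * int h"
    by (simp add: abs_mult)
  also have "\<bar>a - b\<bar> \<le> max a b"
  proof -
    have "0 \<le> a" "0 \<le> b"
      by (simp_all add: a_def b_def)
    then show ?thesis by linarith
  qed
  also have "max a b \<le> int (max x y) ^ k"
    unfolding a_def b_def by (auto intro: power_mono)
  finally have "int p ^ q \<le> int (max x y) ^ k * int h"
    by (simp add: mult_right_mono)
  then have "int (p ^ q) \<le> int (max x y ^ k * h)"
    by simp
  then have "p ^ q \<le> max x y ^ k * h"
    by (simp only: of_nat_le_iff)
  moreover have "2 ^ q \<le> p ^ q"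
    using p2 by (intro power_mono) auto
  ultimately show ?thesis
    unfolding k_def by linarith
qed

text \<open>
  Eliminating \<open>u\<close> gives \<open>M * r ^ h = s ^ f * M'\<close> with \<open>f = t' - t\<close>. As \<open>M\<close> and \<open>M'\<close> have the same
  \<open>p\<close>-valuation, smaller than that of \<open>s\<close>, the \<open>p\<close>-valuations of \<open>r ^ h\<close> and \<open>s ^ f\<close> agree, and the
  congruence makes their \<open>p\<close>-free parts congruent modulo \<open>p ^ q\<close>. The \<open>d\<close>-th powers of these parts
  are \<open>h\<close>-th powers of fixed numbers, so the lifting bound applies: exponents that produce the same
  residue are at least \<open>2 ^ q\<close> apart, up to a constant that depends only on
  \<open>p\<close>, \<open>r\<close> and \<open>s\<close>.
\<close>

lemma orbit_residue_gap:
  fixes p r s u n t t' M M' q h d e :: nat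
  defines "d \<equiv> multiplicity p s" and "e \<equiv> multiplicity p r"
  assumes p: "prime p" and "r > 0" "s > 0" and ne: "r ^ d \<noteq> s ^ e"
    and M: "M > 0" "multiplicity p M < d" and M': "M' > 0" "multiplicity p M' < d"
    and eq: "u * r ^ n = s ^ t * M" and eq': "u * r ^ (n + h) = s ^ t' * M'"
    and "h > 0" "q > 0" and cong: "[M = M'] (mod s ^ q)"
  shows "2 ^ q \<le> max (r ^ d) (s ^ e) ^ (2 * (p - 1)) * h"
proof -
  define c c' where "c = multiplicity p M" and "c' = multiplicity p M'"
  have decompose: "\<exists>y. x = p ^ multiplicity p x * y \<and> \<not> p dvd y" if "x > 0" for x
    using multiplicity_decompose'[of x p] p that not_prime_unit[of p] by blast
  obtain r1 where r: "r = p ^ e * r1" and r1: "\<not> p dvd r1"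
    unfolding e_def using decompose[OF \<open>r > 0\<close>] by blast
  obtain s1 where s: "s = p ^ d * s1" and s1: "\<not> p dvd s1"
    unfolding d_def using decompose[OF \<open>s > 0\<close>] by blast
  obtain M1 where M_eq: "M = p ^ c * M1" and M1: "\<not> p dvd M1"
    unfolding c_def using decompose[OF \<open>M > 0\<close>] by blast
  have pe: "prime_elem p" using p by simp
  have step: "s ^ t * (M * r ^ h) = s ^ t' * M'"
    using eq eq' by (simp add: power_add mult.assoc[symmetric])
  then have "multiplicity p (s ^ t * (M * r ^ h)) = multiplicity p (s ^ t' * M')"
    by simp
  then have val: "t * d + (c + h * e) = t' * d + c'"
    using M M' \<open>r > 0\<close> \<open>s > 0\<close> pe
    by (simp add: prime_elem_multiplicity_mult_distrib prime_elem_multiplicity_power_distrib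
        c_def c'_def d_def e_def)
  have c: "c < d" and c': "c' < d"
    using M M' by (simp_all add: c_def c'_def)
  have "t \<le> t'"
  proof (rule ccontr)
    assume "\<not> t \<le> t'"
    then have "(t' + 1) * d \<le> t * d"
      by (intro mult_right_mono) auto
    with val c' show False
      by simp
  qed
  then obtain f where f: "t' = t + f"
    by (auto simp: le_iff_add)
  have Mr: "M * r ^ h = s ^ f * M'"
    using step \<open>s > 0\<close> by (simp add: f power_add)
  have "p ^ d dvd s"
    unfolding d_def by (rule multiplicity_dvd)
  also have "s dvd s ^ q"
    using \<open>q > 0\<close> by (simp add: dvd_power)
  finally have congd: "[M = M'] (mod p ^ d)"
    using cong cong_dvd_modulus_nat by blast
  have "p ^ k dvd M \<longleftrightarrow> p ^ k dvd M'" if "k \<le> d" for k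
    using cong_dvd_iff[OF cong_dvd_modulus_nat[OF congd le_imp_power_dvd[OF that]]] .
  moreover have "p ^ c dvd M" "p ^ c' dvd M'"
    by (simp_all add: c_def c'_def multiplicity_dvd)
  ultimately have "p ^ c dvd M'" "p ^ c' dvd M"
    using c c' by (simp_all add: less_imp_le)
  then have cc: "c = c'"
    using M M' p not_prime_unit
    by (intro antisym) (auto simp: c_def c'_def intro!: multiplicity_geI)
  have ehdf: "h * e = f * d"
    using val cc by (simp add: f algebra_simps)
  have "int p ^ q dvd int r1 ^ h - int s1 ^ f"
  proof -
    have "[int M = int M'] (mod int (s ^ q))"
      using cong by (simp only: cong_int_iff)
    then have "int s ^ q dvd int M' - int M"
      by (simp add: cong_iff_dvd_diff dvd_diff_commute)
    then obtain k where k: "int M' - int M = int s ^ q * k"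
      by (elim dvdE)
    have "int M * int r ^ h - int M * int s ^ f = int s ^ f * (int M' - int M)"
      using arg_cong[OF Mr, of int] by (simp add: algebra_simps)
    also have "\<dots> = int s ^ f * (int s ^ q * k)"
      by (simp only: k)
    finally have *: "int M * (int r ^ h - int s ^ f) = int s ^ f * (int s ^ q * k)"
      by (simp add: algebra_simps)
    have "int r ^ h = int p ^ (f * d) * int r1 ^ h"
      using ehdf by (simp add: r power_mult_distrib mult.commute flip: power_mult)
    moreover have sf: "int s ^ f = int p ^ (f * d) * int s1 ^ f"
      by (simp add: s power_mult_distrib mult.commute flip: power_mult)
    ultimately have "int p ^ (f * d) * (int M * (int r1 ^ h - int s1 ^ f))
        = int p ^ (f * d) * (int s1 ^ f * (int s ^ q * k))"
      using * by (simp add: algebra_simps)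
    then have **: "int M * (int r1 ^ h - int s1 ^ f) = int s1 ^ f * (int s ^ q * k)"
      using prime_gt_0_nat[OF p] by simp
    \<comment> \<open>dividing by \<open>p ^ c\<close> costs less than one factor \<open>p ^ d\<close> of \<open>s ^ q\<close>\<close>
    have "c + q \<le> d * q"
    proof -
      obtain q0 where "q = Suc q0"
        using \<open>q > 0\<close> by (cases q) auto
      moreover have "q0 \<le> d * q0"
        using c by (cases d) auto
      ultimately have "c + Suc q0 \<le> d + d * q0"
        using c by linarith
      then show ?thesis
        by (simp add: \<open>q = Suc q0\<close>)
    qed
    then have "int p ^ (c + q) dvd int p ^ (d * q)"
      by (rule le_imp_power_dvd)
    also have "int p ^ (d * q) dvd int s ^ q"
      by (simp add: s power_mult_distrib flip: power_mult)
    also have "\<dots> dvd int M * (int r1 ^ h - int s1 ^ f)"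
      unfolding ** by simp
    finally have "int p ^ c * int p ^ q dvd int p ^ c * (int M1 * (int r1 ^ h - int s1 ^ f))"
      by (simp add: M_eq power_add mult.assoc)
    then have "int p ^ q dvd int M1 * (int r1 ^ h - int s1 ^ f)"
      using prime_gt_0_nat[OF p] by simp
    moreover have "coprime (int p ^ q) (int M1)"
      using M1 p by (simp add: prime_imp_coprime)
    ultimately show ?thesis
      by (simp add: coprime_dvd_mult_right_iff)
  qed
  also have "int r1 ^ h - int s1 ^ f dvd (int r1 ^ h) ^ d - (int s1 ^ f) ^ d"
    by (simp add: power_diff_sumr2)
  also have "(int r1 ^ h) ^ d - (int s1 ^ f) ^ d = int (r1 ^ d) ^ h - int (s1 ^ e) ^ h"
    using ehdf by (simp add: mult.commute flip: power_mult)
  finally have "2 ^ q \<le> max (r1 ^ d) (s1 ^ e) ^ (2 * (p - 1)) * h"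
  proof (intro prime_power_dvd_power_diff_bound p \<open>h > 0\<close>)
    show "\<not> p dvd r1 ^ d" "\<not> p dvd s1 ^ e"
      using r1 s1 p prime_dvd_power by blast+
    have "r ^ d = p ^ (d * e) * r1 ^ d"
      by (simp add: r power_mult_distrib mult.commute flip: power_mult)
    moreover have "s ^ e = p ^ (d * e) * s1 ^ e"
      by (simp add: s power_mult_distrib flip: power_mult)
    ultimately show "r1 ^ d \<noteq> s1 ^ e"
      using ne by auto
  qed
  also have "max (r1 ^ d) (s1 ^ e) \<le> max (r ^ d) (s ^ e)"
  proof (intro max.mono power_mono)
    show "r1 \<le> r" "s1 \<le> s"
      using r s \<open>r > 0\<close> \<open>s > 0\<close> by (auto intro: dvd_imp_le)
  qed auto
  finally show ?thesis
    by (simp add: power_mono)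
qed

section \<open>Mixed pairs of digits\<close>

text \<open>
  The digits of \<open>z\<close> in positions \<open>k\<close> and \<open>k + 1\<close> are not both \<open>0\<close> and not both \<open>s - 1\<close>; in other
  words, the fractional part of \<open>z / s ^ (k + 2)\<close> is at distance at least \<open>1 / s\<^sup>2\<close> from \<open>0\<close> and \<open>1\<close>.
\<close>

definition mixed :: "nat \<Rightarrow> nat \<Rightarrow> nat \<Rightarrow> bool" where
  "mixed s z k \<longleftrightarrow> z div s ^ k mod s\<^sup>2 \<notin> {0, s\<^sup>2 - 1}"

text \<open>
  Only finite initial segments of positions are counted, because \<open>card\<close> is \<open>0\<close> on infinite sets.
\<close>

definition few_mixed :: "nat \<Rightarrow> nat \<Rightarrow> nat \<Rightarrow> bool" where
  "few_mixed s w z \<longleftrightarrow> (\<forall>q. card {k. k < q \<and> mixed s z k} \<le> w)"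

lemma mixed_div_power: "mixed s (z div s ^ i) k \<longleftrightarrow> mixed s z (i + k)"
  by (simp add: mixed_def div_mult2_eq power_add)

lemma few_mixed_div_power:
  assumes "few_mixed s w z"
  shows "few_mixed s w (z div s ^ i)"
  unfolding few_mixed_def
proof
  fix q
  have "card {k. k < q \<and> mixed s (z div s ^ i) k} \<le> card {k. k < i + q \<and> mixed s z k}"
    by (rule card_inj_on_le[where f = "\<lambda>k. i + k"]) (auto simp: mixed_div_power)
  also have "\<dots> \<le> w"
    using assms by (simp add: few_mixed_def)
  finally show "card {k. k < q \<and> mixed s (z div s ^ i) k} \<le> w" .
qed

lemma mixed_mod_power:
  assumes "s > 0" "k + 2 \<le> q"
  shows "mixed s (z mod s ^ q) k \<longleftrightarrow> mixed s z k"
proof -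
  have "q = k + (2 + (q - k - 2))"
    using assms by simp
  then have "s ^ q = s ^ k * (s\<^sup>2 * s ^ (q - k - 2))"
    by (metis power_add)
  then have "z mod s ^ q div s ^ k = (z div s ^ k) mod (s\<^sup>2 * s ^ (q - k - 2))"
    using assms(1) by (simp add: mod_mult2_eq)
  then show ?thesis
    by (simp add: mixed_def mod_mult2_eq)
qed

lemma two_digits_extreme:
  fixes s a b :: nat
  assumes "s \<ge> 2" "a < s" "b < s"
  shows "s * a + b \<in> {0, s\<^sup>2 - 1} \<longleftrightarrow> a = 0 \<and> b = 0 \<or> a = s - 1 \<and> b = s - 1"
proof -
  have "s * (s - 1) + (s - 1) = s\<^sup>2 - 1"
    using assms by (simp add: power2_eq_square diff_mult_distrib2)
  moreover have "a = a' \<and> b = b'" if "s * a + b = s * a' + b'" "b' < s" for a' b'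
  proof
    have "a = (s * a + b) div s" "b = (s * a + b) mod s"
      using assms by simp_all
    then show "a = a'" "b = b'"
      unfolding that(1) using assms that(2) by simp_all
  qed
  ultimately show ?thesis
    using assms by (metis (no_types, lifting) add_0 diff_less empty_iff insert_iff mult_0_right
      not_numeral_le_zero zero_less_one gr0I)
qed

text \<open>
  Along a run without mixed pairs the digit can never change, so all digits of the run are \<open>0\<close> or
  all are \<open>s - 1\<close>.
\<close>

lemma unmixed_run_mod:
  assumes "s \<ge> 2" and "\<And>k. k \<le> g \<Longrightarrow> \<not> mixed s z k"
  shows "z mod s ^ (g + 2) \<in> {0, s ^ (g + 2) - 1}"
  using assms(2)
proof (induction g arbitrary: z)
  case 0
  from "0"[of 0] show ?case
    by (simp add: mixed_def power2_eq_square)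
next
  case (Suc g)
  define y where "y = z div s"
  define P where "P = s ^ (g + 1)"
  have P: "P \<ge> 1" "s ^ (g + 2) = s * P" "s ^ (Suc g + 2) = s * (s * P)"
    using assms(1) by (simp_all add: P_def)
  have s1: "s \<ge> 2" by fact
  have "y mod s ^ (g + 2) \<in> {0, s ^ (g + 2) - 1}"
    unfolding y_def using Suc.prems[of "Suc _"] mixed_div_power[of s z 1]
    by (intro Suc.IH) auto
  then have y: "y mod (s * P) \<in> {0, s * P - 1}"
    by (simp only: P(2))
  have y0: "y mod s = y mod (s * P) mod s"
    by (simp add: mod_mult2_eq)
  have last: "(s * P - 1) mod s = s - 1"
  proof -
    obtain P0 where "P = Suc P0"
      using P(1) by (cases P) auto
    then have "s * P - 1 = (s - 1) + s * P0"
      using s1 by simp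
    then show ?thesis
      using s1 by (simp only: mod_mult_self2) simp
  qed
  have "z mod s\<^sup>2 = s * (y mod s) + z mod s"
    by (simp add: power2_eq_square mod_mult2_eq y_def)
  then have "s * (y mod s) + z mod s \<in> {0, s\<^sup>2 - 1}"
    using Suc.prems[of 0] by (simp add: mixed_def)
  then consider "y mod s = 0" "z mod s = 0" | "y mod s = s - 1" "z mod s = s - 1"
    using two_digits_extreme[OF s1, of "y mod s" "z mod s"] s1 by auto
  then show ?case
  proof cases
    case 1
    then have "y mod (s * P) = 0"
      using y y0 last s1 by auto
    with 1 show ?thesis
      by (simp only: P mod_mult2_eq[of z s "s * P"] y_def[symmetric]) simp
  next
    case 2
    then have "y mod (s * P) = s * P - 1"
      using y y0 s1 by auto
    moreover have "s * (s * P - 1) + (s - 1) = s * (s * P) - 1"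
      using s1 P(1) by (simp add: diff_mult_distrib2)
    ultimately show ?thesis
      using 2 by (simp only: P mod_mult2_eq[of z s "s * P"] y_def[symmetric]) simp
  qed
qed

text \<open>
  Appending a lowest digit to \<open>y\<close> creates a new pair that is unmixed for at most one choice of that
  digit, so each position contributes a factor of at most \<open>1 + s * x\<close> to the generating function.
  The initial factor \<open>s\<close> stands for the highest digit.
\<close>

lemma sum_count_base_power:
  fixes x :: real and s :: nat
  defines "mc q z \<equiv> card {k. k < q \<and> mixed s z k}"
  assumes "s \<ge> 2" and "0 \<le> x" "x \<le> 1"
  shows "(\<Sum>z<s ^ (q + 1). x ^ mc q z) \<le> real s * (1 + real s * x) ^ q"
proof (induction q)
  case 0
  then show ?case by (simp add: mc_def)
next
  case (Suc q)
  have split: "(\<Sum>z<s * m. f z) = (\<Sum>y<m. \<Sum>c<s. f (s * y + c))" for f :: "nat \<Rightarrow> real" and m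
  proof -
    have "sum f {y * s..<y * s + s} = (\<Sum>c<s. f (s * y + c))" for y
      by (rule sum.reindex_bij_witness[of _ "\<lambda>c. s * y + c" "\<lambda>z. z - s * y"])
        (auto simp: mult.commute)
    then show ?thesis
      using sum.nat_group[of f s m] by (simp add: mult.commute)
  qed
  have mc: "mc (Suc q) (s * y + c) = of_bool (mixed s (s * y + c) 0) + mc q y" if "c < s" for y c
  proof -
    let ?z = "s * y + c"
    have "?z div s ^ 1 = y"
      using that by simp
    then have shift: "mixed s ?z (Suc k) \<longleftrightarrow> mixed s y k" for k
      using mixed_div_power[of s ?z 1 k] by simp
    have "{k. k < Suc q \<and> mixed s ?z k} =
        {k. k = 0 \<and> mixed s ?z 0} \<union> Suc ` {k. k < q \<and> mixed s y k}"
      by (auto simp: shift image_iff less_Suc_eq_0_disj)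
    then have "card {k. k < Suc q \<and> mixed s ?z k}
        = card ({k. k = 0 \<and> mixed s ?z 0} \<union> Suc ` {k. k < q \<and> mixed s y k})"
      by (rule arg_cong)
    also have "\<dots> = card {k::nat. k = 0 \<and> mixed s ?z 0} + card (Suc ` {k. k < q \<and> mixed s y k})"
      by (intro card_Un_disjoint) auto
    finally show ?thesis
      by (simp add: mc_def card_image)
  qed
  have unmixed: "card {c. c < s \<and> \<not> mixed s (s * y + c) 0} \<le> 1" for y
  proof -
    have "(s * y + c) mod s\<^sup>2 = s * (y mod s) + c" if "c < s" for c
      using that by (simp add: power2_eq_square mod_mult2_eq)
    then have "\<not> mixed s (s * y + c) 0 \<longleftrightarrow> s * (y mod s) + c \<in> {0, s\<^sup>2 - 1}" if "c < s" for c
      using that by (simp add: mixed_def)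
    then have "\<not> mixed s (s * y + c) 0 \<Longrightarrow> c = y mod s" if "c < s" for c
      using assms that two_digits_extreme[of s "y mod s" c] by auto
    then have "{c. c < s \<and> \<not> mixed s (s * y + c) 0} \<subseteq> {y mod s}"
      by blast
    then have "card {c. c < s \<and> \<not> mixed s (s * y + c) 0} \<le> card {y mod s}"
      by (intro card_mono) auto
    then show ?thesis by simp
  qed
  have inner: "(\<Sum>c<s. x ^ of_bool (mixed s (s * y + c) 0)) \<le> 1 + real s * x" for y
  proof -
    have "(\<Sum>c<s. x ^ of_bool (mixed s (s * y + c) 0))
        \<le> (\<Sum>c<s. of_bool (\<not> mixed s (s * y + c) 0) + x)"
      using assms by (intro sum_mono) auto
    also have "\<dots> = real (card {c. c < s \<and> \<not> mixed s (s * y + c) 0}) + real s * x"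
    proof -
      have "{c. c < s \<and> \<not> mixed s (s * y + c) 0} = {..<s} \<inter> {c. \<not> mixed s (s * y + c) 0}"
        by auto
      then show ?thesis
        by (simp add: sum.distrib sum_of_bool_eq del: of_bool_not_iff)
    qed
    finally show ?thesis
      using unmixed[of y] by linarith
  qed
  have "(\<Sum>z<s ^ (Suc q + 1). x ^ mc (Suc q) z) = (\<Sum>z<s * s ^ (q + 1). x ^ mc (Suc q) z)"
    by simp
  also have "\<dots> = (\<Sum>y<s ^ (q + 1). \<Sum>c<s. x ^ mc (Suc q) (s * y + c))"
    by (rule split)
  also have "\<dots> = (\<Sum>y<s ^ (q + 1). (\<Sum>c<s. x ^ of_bool (mixed s (s * y + c) 0)) * x ^ mc q y)"
    by (intro sum.cong refl) (simp add: mc power_add sum_distrib_right)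
  also have "\<dots> \<le> (\<Sum>y<s ^ (q + 1). (1 + real s * x) * x ^ mc q y)"
    using assms by (intro sum_mono mult_right_mono inner) auto
  also have "\<dots> = (1 + real s * x) * (\<Sum>y<s ^ (q + 1). x ^ mc q y)"
    by (simp add: sum_distrib_left)
  also have "\<dots> \<le> (1 + real s * x) * (real s * (1 + real s * x) ^ q)"
    using assms by (intro mult_left_mono Suc.IH) auto
  finally show ?case
    by (simp add: algebra_simps)
qed

text \<open>
  Markov's inequality for the generating function: a residue with at most \<open>w\<close> mixed pairs has
  weight at least \<open>x ^ w\<close>.
\<close>

lemma card_few_mixed_residues:
  fixes x :: real and s w q :: nat
  assumes "s \<ge> 2" and "0 < x" "x \<le> 1"
  shows "real (card ((\<lambda>z. z mod s ^ (q + 1)) ` {z. few_mixed s w z}))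
    \<le> real s * (1 + real s * x) ^ q / x ^ w"
proof -
  let ?R = "(\<lambda>z. z mod s ^ (q + 1)) ` {z. few_mixed s w z}"
  have sub: "?R \<subseteq> {..<s ^ (q + 1)}"
    using assms by auto
  have fin: "finite ?R"
    using sub finite_subset by blast
  have "x ^ w \<le> x ^ card {k. k < q \<and> mixed s y k}" if "y \<in> ?R" for y
  proof (rule power_decreasing)
    obtain z where z: "few_mixed s w z" "y = z mod s ^ (q + 1)"
      using \<open>y \<in> ?R\<close> by blast
    have "mixed s y k \<longleftrightarrow> mixed s z k" if "k + 2 \<le> q + 1" for k
      using mixed_mod_power[OF _ that] assms z by simp
    then have "{k. k < q \<and> mixed s y k} = {k. k < q \<and> mixed s z k}"
      by auto
    then show "card {k. k < q \<and> mixed s y k} \<le> w"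
      using z by (simp add: few_mixed_def)
  qed (use assms in auto)
  then have "real (card ?R) * x ^ w \<le> (\<Sum>y\<in>?R. x ^ card {k. k < q \<and> mixed s y k})"
    using sum_bounded_below[of ?R "x ^ w"] by simp
  also have "\<dots> \<le> (\<Sum>y<s ^ (q + 1). x ^ card {k. k < q \<and> mixed s y k})"
    using assms sub by (intro sum_mono2) auto
  also have "\<dots> \<le> real s * (1 + real s * x) ^ q"
    using assms by (intro sum_count_base_power) auto
  finally show ?thesis
    using assms by (simp add: pos_le_divide_eq)
qed

text \<open>
  Among \<open>w + 1\<close> consecutive runs of \<open>G\<close> positions one contains no mixed pair. Its digits are
  constantly \<open>0\<close> or constantly \<open>s - 1\<close>, so rounding down, respectively up, at its upper end changes
  \<open>z\<close> by at most \<open>s ^ i\<close>, where \<open>i\<close> is its lower end.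
\<close>

lemma few_mixed_near_multiple:
  fixes s w z G :: nat
  assumes s: "s \<ge> 2" and sp: "few_mixed s w z" and G: "G > 0"
  obtains u j where "j \<le> w" "z < u * s ^ (j * G + G + 1) + s ^ (j * G)"
    "u * s ^ (j * G + G + 1) \<le> z + s ^ (j * G)"
proof -
  obtain j where j: "j \<le> w" "\<And>k. k < G \<Longrightarrow> \<not> mixed s z (j * G + k)"
  proof (rule ccontr)
    assume "\<not> thesis"
    then have "\<forall>j\<le>w. \<exists>k<G. mixed s z (j * G + k)"
      using that by blast
    then obtain g where g: "\<And>j. j \<le> w \<Longrightarrow> g j < G \<and> mixed s z (j * G + g j)"
      by metis
    have inj: "inj_on (\<lambda>j. j * G + g j) {..w}"
    proof (rule inj_onI)
      fix i j assume "i \<in> {..w}" "j \<in> {..w}" and eq: "i * G + g i = j * G + g j"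
      then have "g i < G" "g j < G"
        using g by auto
      then have "(i * G + g i) div G = i" "(j * G + g j) div G = j"
        using G by simp_all
      with eq show "i = j" by metis
    qed
    have "(\<lambda>j. j * G + g j) ` {..w} \<subseteq> {k. k < (w + 1) * G \<and> mixed s z k}"
    proof (rule image_subsetI)
      fix j assume "j \<in> {..w}"
      then have j: "j + 1 \<le> w + 1" "g j < G" "mixed s z (j * G + g j)"
        using g by auto
      have "j * G + g j < (j + 1) * G"
        using j by simp
      also have "\<dots> \<le> (w + 1) * G"
        using j(1) by (rule mult_le_mono1)
      finally show "j * G + g j \<in> {k. k < (w + 1) * G \<and> mixed s z k}"
        using j by simp
    qed
    then have "card ((\<lambda>j. j * G + g j) ` {..w}) \<le> card {k. k < (w + 1) * G \<and> mixed s z k}"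
      by (intro card_mono) auto
    then have "w + 1 \<le> card {k. k < (w + 1) * G \<and> mixed s z k}"
      by (simp only: card_image[OF inj] card_atMost Suc_eq_plus1)
    moreover have "card {k. k < (w + 1) * G \<and> mixed s z k} \<le> w"
      using sp unfolding few_mixed_def by blast
    ultimately show False by linarith
  qed
  define i where "i = j * G"
  define v where "v = z div s ^ i"
  define P where "P = s ^ (G + 1)"
  have v: "v mod P \<in> {0, P - 1}"
  proof -
    have "v mod s ^ (G - 1 + 2) \<in> {0, s ^ (G - 1 + 2) - 1}"
      using j G by (intro unmixed_run_mod s) (simp add: v_def i_def mixed_div_power)
    then show ?thesis
      using G by (simp add: P_def numeral_2_eq_2)
  qed
  have P0: "P > 0" and s0: "s ^ i > 0"
    using s by (simp_all add: P_def)
  \<comment> \<open>the successor makes a run of digits \<open>s - 1\<close> round up\<close>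
  define u where "u = (v + 1) div P"
  have u: "u * P \<le> v + 1 \<and> v \<le> u * P"
  proof (cases "v mod P = P - 1")
    case True
    then have "(v + 1) mod P = 0"
      using P0 by (simp add: mod_Suc)
    then have "u * P = v + 1"
      unfolding u_def by (metis add.right_neutral div_mult_mod_eq)
    then show ?thesis by simp
  next
    case False
    with v have "v mod P = 0" by simp
    then have "v = (v div P) * P"
      by (metis add.right_neutral div_mult_mod_eq)
    moreover have "v div P \<le> u"
      unfolding u_def by (intro div_le_mono) simp
    ultimately have "v \<le> u * P"
      by (metis mult_le_mono1)
    then show ?thesis
      by (simp add: u_def)
  qed
  have zv: "v * s ^ i \<le> z" "z < (v + 1) * s ^ i"
    using s0 by (simp_all add: v_def dividend_less_times_div mult.commute)
  have pw: "u * s ^ (i + G + 1) = u * P * s ^ i"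
    by (simp add: P_def power_add)
  show ?thesis
  proof (rule that[OF j(1), of u, folded i_def])
    note zv(2)
    also have "(v + 1) * s ^ i \<le> (u * P + 1) * s ^ i"
      using u by (intro mult_le_mono1) auto
    also have "\<dots> = u * s ^ (i + G + 1) + s ^ i"
      unfolding pw by (simp add: add_mult_distrib)
    finally show "z < u * s ^ (i + G + 1) + s ^ i" .
    have "u * s ^ (i + G + 1) \<le> (v + 1) * s ^ i"
      unfolding pw using u by (intro mult_le_mono1) auto
    also have "\<dots> = v * s ^ i + s ^ i"
      by simp
    also have "\<dots> \<le> z + s ^ i"
      using zv(1) by (rule add_le_mono1)
    finally show "u * s ^ (i + G + 1) \<le> z + s ^ i" .
  qed
qed

section \<open>Iterates with few mixed pairs\<close>

text \<open>
  Each \<open>h\<close> is encoded by a prime \<open>p dvd s\<close> at which the cofactor \<open>M\<close> of \<open>s ^ t\<close> in \<open>u * r ^ h\<close> has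
  smaller valuation than \<open>s\<close>, by the alternative that holds for \<open>h\<close>, and by the residue of \<open>M\<close> or
  \<open>M - 1\<close>. The encoding is injective because equal codes force a gap of at least \<open>H\<close>. Passing
  from \<open>u * r ^ h - 1\<close> to \<open>M - 1\<close> only removes the lowest \<open>t\<close> digits, all of which are \<open>s - 1\<close>.
\<close>

lemma card_few_mixed_orbit:
  fixes r s u w q H :: nat
  assumes r: "r > 1" and s: "s > 1" and "u > 0"
    and indep: "\<And>i j. i > 0 \<Longrightarrow> r ^ i \<noteq> s ^ j"
    and large: "\<And>p. prime p \<Longrightarrow> p dvd s \<Longrightarrow>
      max (r ^ multiplicity p s) (s ^ multiplicity p r) ^ (2 * (p - 1)) * H \<le> 2 ^ (q + 1)"
  shows "card {h. h < H \<and> (few_mixed s w (u * r ^ h) \<or> few_mixed s w (u * r ^ h - 1))}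
    \<le> 2 * s * card ((\<lambda>z. z mod s ^ (q + 1)) ` {z. few_mixed s w z})"
proof -
  let ?A = "{h. h < H \<and> (few_mixed s w (u * r ^ h) \<or> few_mixed s w (u * r ^ h - 1))}"
  let ?R = "(\<lambda>z. z mod s ^ (q + 1)) ` {z. few_mixed s w z}"
  have finR: "finite ?R"
    by (rule finite_subset[of _ "{..<s ^ (q + 1)}"]) (use s in auto)
  have "\<exists>t M p. u * r ^ h = s ^ t * M \<and> M > 0 \<and> prime p \<and> p dvd s \<and>
      multiplicity p M < multiplicity p s" for h
  proof -
    have pos: "u * r ^ h \<noteq> 0"
      using \<open>u > 0\<close> r by simp
    then obtain M where M: "u * r ^ h = s ^ multiplicity s (u * r ^ h) * M" "\<not> s dvd M"
      using multiplicity_decompose'[of "u * r ^ h" s] s by auto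
    have "M > 0"
      using M by (intro gr0I) auto
    then have "\<exists>p. prime p \<and> \<not> multiplicity p s \<le> multiplicity p M"
      using M multiplicity_le_imp_dvd[of s M] s by (metis gr_implies_not0)
    then obtain p where p: "prime p" "multiplicity p M < multiplicity p s"
      by (auto simp: not_le)
    then have "p dvd s"
      using not_dvd_imp_multiplicity_0[of p s] by fastforce
    with M \<open>M > 0\<close> p show ?thesis
      by blast
  qed
  then obtain t M p where
    eq: "\<And>h. u * r ^ h = s ^ t h * M h" and M: "\<And>h. M h > 0" and
    p: "\<And>h. prime (p h)" "\<And>h. p h dvd s" and
    mult: "\<And>h. multiplicity (p h) (M h) < multiplicity (p h) s"
    by metis
  define b where "b h = (if few_mixed s w (u * r ^ h) then 0 else 1 :: nat)" for h
  define \<phi> where "\<phi> h = (p h, b h, (M h - b h) mod s ^ (q + 1))" for h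
  have lt_imp_ne: "\<phi> h \<noteq> \<phi> h'" if "h < h'" "h' < H" for h h'
  proof
    assume same: "\<phi> h = \<phi> h'"
    then have eqs: "p h = p h' \<and> b h = b h' \<and>
        (M h - b h) mod s ^ (q + 1) = (M h' - b h') mod s ^ (q + 1)"
      unfolding \<phi>_def prod.inject .
    then have pp: "p h' = p h" and bb: "b h' = b h"
      by simp_all
    have "[M h - b h = M h' - b h] (mod s ^ (q + 1))"
      using eqs unfolding cong_def bb by blast
    then have "[M h - b h + b h = M h' - b h + b h] (mod s ^ (q + 1))"
      by (intro cong_add cong_refl)
    moreover have "b h \<le> M h" "b h \<le> M h'"
      using M[of h] M[of h'] by (auto simp: b_def)
    ultimately have cong: "[M h = M h'] (mod s ^ (q + 1))"
      by simp
    let ?C = "max (r ^ multiplicity (p h) s) (s ^ multiplicity (p h) r) ^ (2 * (p h - 1))"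
    have "2 ^ (q + 1) \<le> ?C * (h' - h)"
    proof (rule orbit_residue_gap[of "p h" r s "M h" "M h'" u h "t h" "h' - h" "t h'"])
      show "r ^ multiplicity (p h) s \<noteq> s ^ multiplicity (p h) r"
        using mult[of h] by (intro indep) simp
      show "multiplicity (p h) (M h') < multiplicity (p h) s"
        using mult[of h'] pp by simp
      show "u * r ^ (h + (h' - h)) = s ^ t h' * M h'"
        using eq[of h'] that by simp
    qed (use p M mult eq cong that r s in auto)
    also have "\<dots> < ?C * H"
      using that r by (intro mult_strict_left_mono) (auto simp: less_max_iff_disj)
    also have "\<dots> \<le> 2 ^ (q + 1)"
      using p by (intro large) auto
    finally show False by simp
  qed
  have inj: "inj_on \<phi> ?A"
    by (rule linorder_inj_onI) (use lt_imp_ne in auto)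
  have "\<phi> ` ?A \<subseteq> {1..s} \<times> {0, 1} \<times> ?R"
  proof (rule image_subsetI)
    fix h assume h: "h \<in> ?A"
    have pos: "s ^ t h > 0"
      using s by simp
    have "few_mixed s w ((u * r ^ h - b h) div s ^ t h)"
      using h by (intro few_mixed_div_power) (auto simp: b_def)
    also have "(u * r ^ h - b h) div s ^ t h = M h - b h"
    proof (cases "b h = 0")
      case False
      then have "u * r ^ h - b h = (M h - 1) * s ^ t h + (s ^ t h - 1)"
        using M[of h] pos by (cases "M h") (auto simp: eq b_def mult.commute)
      moreover have "b h = 1"
        using False by (simp add: b_def split: if_splits)
      moreover have "((M h - 1) * s ^ t h + (s ^ t h - 1)) div s ^ t h = M h - 1"
        using pos by (simp only: div_mult_self3) simp
      ultimately show ?thesis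
        by simp
    qed (use pos eq in simp)
    finally have "(M h - b h) mod s ^ (q + 1) \<in> ?R"
      by blast
    moreover have "p h \<in> {1..s}"
      using p[of h] s prime_gt_0_nat[of "p h"] by (auto dest: dvd_imp_le)
    ultimately show "\<phi> h \<in> {1..s} \<times> {0, 1} \<times> ?R"
      by (auto simp: \<phi>_def b_def)
  qed
  then have "card (\<phi> ` ?A) \<le> card ({1..s} \<times> {0, 1 :: nat} \<times> ?R)"
    using finR by (intro card_mono) auto
  also have "\<dots> = 2 * s * card ?R"
    by (simp only: card_cartesian_product) (simp add: algebra_simps)
  finally show ?thesis
    by (simp only: card_image[OF inj])
qed

text \<open>
  A run of \<open>G\<close> unmixed positions puts \<open>Y\<close> within \<open>s ^ (K + i)\<close> of \<open>u * s ^ E\<close>, where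
  \<open>E = K + i + G + 1\<close>. Since \<open>r ^ h \<le> s ^ G\<close>, the error stays below \<open>s ^ E\<close> after multiplication
  by \<open>r ^ h\<close>, and the digits from position \<open>E\<close> on are those of \<open>u * r ^ h\<close> or \<open>u * r ^ h - 1\<close>. The
  lower bound on \<open>Y div s ^ K\<close> excludes \<open>u = 0\<close>.
\<close>

lemma card_few_mixed_block:
  fixes r s w q H G K Y :: nat
  assumes r: "r > 1" and s: "s > 1"
    and indep: "\<And>i j. i > 0 \<Longrightarrow> r ^ i \<noteq> s ^ j"
    and large: "\<And>p. prime p \<Longrightarrow> p dvd s \<Longrightarrow>
      max (r ^ multiplicity p s) (s ^ multiplicity p r) ^ (2 * (p - 1)) * H \<le> 2 ^ (q + 1)"
    and G: "G > 0" "r ^ H \<le> s ^ G"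
    and sp: "few_mixed s w (Y div s ^ K)" and size: "s ^ (w * G) \<le> Y div s ^ K"
  shows "card {h. h < H \<and> few_mixed s w (Y * r ^ h div s ^ K)}
    \<le> 2 * s * card ((\<lambda>z. z mod s ^ (q + 1)) ` {z. few_mixed s w z})"
proof -
  define Z where "Z = Y div s ^ K"
  have s2: "s \<ge> 2" using s by simp
  obtain u j where j: "j \<le> w" "Z < u * s ^ (j * G + G + 1) + s ^ (j * G)"
    "u * s ^ (j * G + G + 1) \<le> Z + s ^ (j * G)"
    using few_mixed_near_multiple[OF s2 sp G(1)] unfolding Z_def by blast
  define i where "i = j * G"
  define E where "E = K + (i + G + 1)"
  have "s ^ i \<le> s ^ (w * G)"
    using j s by (intro power_increasing) (auto simp: i_def)
  with size j have "u > 0"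
    by (intro gr0I) (auto simp: Z_def i_def)
  have sK: "s ^ K > 0" using s by simp
  have ZY: "s ^ K * Z \<le> Y" "Y < s ^ K * (Z + 1)"
    using sK by (simp_all add: Z_def dividend_less_times_div)
  have upper: "Y \<le> u * s ^ E + s ^ (K + i)"
  proof -
    have "s ^ K * (Z + 1) \<le> s ^ K * (u * s ^ (i + G + 1) + s ^ i)"
      using j by (intro mult_left_mono) (auto simp: i_def)
    with ZY show ?thesis
      by (simp add: E_def power_add algebra_simps)
  qed
  have lower: "u * s ^ E \<le> Y + s ^ (K + i)"
  proof -
    have "s ^ K * (u * s ^ (i + G + 1)) \<le> s ^ K * (Z + s ^ i)"
      using j by (intro mult_left_mono) (auto simp: i_def)
    with ZY show ?thesis
      by (simp add: E_def power_add algebra_simps)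
  qed
  have sub: "{h. h < H \<and> few_mixed s w (Y * r ^ h div s ^ K)}
      \<subseteq> {h. h < H \<and> (few_mixed s w (u * r ^ h) \<or> few_mixed s w (u * r ^ h - 1))}"
  proof
    fix h assume "h \<in> {h. h < H \<and> few_mixed s w (Y * r ^ h div s ^ K)}"
    then have h: "h < H" "few_mixed s w (Y * r ^ h div s ^ K)"
      by simp_all
    have "r ^ h \<le> r ^ H"
      using h r by (intro power_increasing) auto
    then have "s ^ (K + i) * r ^ h \<le> s ^ (K + i) * s ^ G"
      using G by (intro mult_left_mono) auto
    also have "\<dots> = s ^ (K + i + G)"
      by (rule power_add[symmetric])
    also have "\<dots> < s ^ E"
      using s by (intro power_strict_increasing) (auto simp: E_def)
    finally have err: "s ^ (K + i) * r ^ h < s ^ E" .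
    define c where "c = Y * r ^ h div s ^ E"
    have "few_mixed s w (Y * r ^ h div s ^ K div s ^ (i + G + 1))"
      using h(2) by (rule few_mixed_div_power)
    then have c: "few_mixed s w c"
      by (simp only: c_def E_def power_add[of s K "i + G + 1"] div_mult2_eq)
    have "Y * r ^ h \<le> (u * s ^ E + s ^ (K + i)) * r ^ h"
      using upper by (rule mult_right_mono) simp
    also have "\<dots> < (u * r ^ h + 1) * s ^ E"
      using err by (simp add: algebra_simps)
    finally have "c < u * r ^ h + 1"
      unfolding c_def by (simp add: less_mult_imp_div_less)
    moreover have "u * r ^ h \<le> c + 1"
    proof -
      have "u * s ^ E * r ^ h \<le> (Y + s ^ (K + i)) * r ^ h"
        using lower by (rule mult_right_mono) simp
      also have "\<dots> < Y * r ^ h + s ^ E"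
        using err by (simp add: algebra_simps)
      also have "Y * r ^ h < (c + 1) * s ^ E"
        using s by (simp add: c_def dividend_less_div_times)
      finally have "(u * r ^ h) * s ^ E < (c + 2) * s ^ E"
        by (simp add: algebra_simps)
      then have "u * r ^ h < c + 2"
        using mult_less_cancel2 by blast
      then show ?thesis by simp
    qed
    ultimately have "c = u * r ^ h \<or> c = u * r ^ h - 1"
      by linarith
    with c h show "h \<in> {h. h < H \<and>
        (few_mixed s w (u * r ^ h) \<or> few_mixed s w (u * r ^ h - 1))}"
      by auto
  qed
  have "card {h. h < H \<and> few_mixed s w (Y * r ^ h div s ^ K)}
      \<le> card {h. h < H \<and> (few_mixed s w (u * r ^ h) \<or> few_mixed s w (u * r ^ h - 1))}"
    using sub by (intro card_mono) auto
  also have "\<dots> \<le> 2 * s * card ((\<lambda>z. z mod s ^ (q + 1)) ` {z. few_mixed s w z})"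
    by (intro card_few_mixed_orbit r s \<open>u > 0\<close> indep large)
  finally show ?thesis .
qed

text \<open>
  The first exceptional index \<open>n0 \<ge> n1\<close> of each block of length \<open>H\<close> serves as the starting point for
  the rest of the block. The \<open>n1\<close> smallest indices are given up, so that \<open>r ^ n0\<close>, and with it
  \<open>(l * r ^ n0) div s ^ K\<close>, reaches the lower end of each of \<open>w + 1\<close> consecutive runs of \<open>G\<close> positions.
\<close>

lemma card_few_mixed_total:
  fixes r s w q H G K l n1 N :: nat
  assumes r: "r > 1" and s: "s > 1"
    and indep: "\<And>i j. i > 0 \<Longrightarrow> r ^ i \<noteq> s ^ j"
    and large: "\<And>p. prime p \<Longrightarrow> p dvd s \<Longrightarrow>
      max (r ^ multiplicity p s) (s ^ multiplicity p r) ^ (2 * (p - 1)) * H \<le> 2 ^ (q + 1)"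
    and G: "G > 0" "r ^ H \<le> s ^ G" and "H > 0"
    and l: "s ^ K \<le> l" and n1: "s ^ (w * G) \<le> r ^ n1"
  shows "card {n. n < N \<and> few_mixed s w (l * r ^ n div s ^ K)}
    \<le> n1 + (N div H + 1) * (2 * s * card ((\<lambda>z. z mod s ^ (q + 1)) ` {z. few_mixed s w z}))"
proof -
  define B where "B = 2 * s * card ((\<lambda>z. z mod s ^ (q + 1)) ` {z. few_mixed s w z})"
  define S where "S b = {n. n div H = b \<and> n \<ge> n1 \<and> few_mixed s w (l * r ^ n div s ^ K)}" for b
  have S: "finite (S b) \<and> card (S b) \<le> B" for b
  proof (cases "S b = {}")
    case False
    define n0 where "n0 = (LEAST n. n \<in> S b)"
    have n0: "n0 \<in> S b" and least: "\<And>n. n \<in> S b \<Longrightarrow> n0 \<le> n"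
      using False unfolding n0_def by (auto intro: LeastI Least_le)
    define Y where "Y = l * r ^ n0"
    have "s ^ (w * G) \<le> r ^ n1" by fact
    also have "\<dots> \<le> r ^ n0"
      using n0 r by (intro power_increasing) (auto simp: S_def)
    also have "\<dots> = s ^ K * r ^ n0 div s ^ K"
      using s by simp
    also have "\<dots> \<le> Y div s ^ K"
      using l unfolding Y_def by (intro div_le_mono mult_right_mono) auto
    finally have size: "s ^ (w * G) \<le> Y div s ^ K" .
    have sub: "S b \<subseteq> (\<lambda>h. n0 + h) ` {h. h < H \<and> few_mixed s w (Y * r ^ h div s ^ K)}"
    proof
      fix n assume n: "n \<in> S b"
      have "n = n0 + (n - n0)"
        using least[OF n] by simp
      moreover have "n - n0 < H"
      proof -
        have "n div H = b" "n0 div H = b"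
          using n n0 by (simp_all add: S_def)
        moreover have "n < n div H * H + H" "n0 div H * H \<le> n0"
          using dividend_less_div_times[of H n] \<open>H > 0\<close> by (simp_all add: add.commute)
        ultimately show ?thesis
          using \<open>H > 0\<close> by simp
      qed
      moreover have "Y * r ^ (n - n0) = l * r ^ n"
        using least[OF n] by (simp add: Y_def mult.assoc flip: power_add)
      ultimately show "n \<in> (\<lambda>h. n0 + h) ` {h. h < H \<and> few_mixed s w (Y * r ^ h div s ^ K)}"
        using n by (intro image_eqI[of _ _ "n - n0"]) (auto simp: S_def)
    qed
    have "card (S b) \<le> card {h. h < H \<and> few_mixed s w (Y * r ^ h div s ^ K)}"
      using sub by (intro surj_card_le) auto
    also have "\<dots> \<le> B"
      unfolding B_def using n0
      by (intro card_few_mixed_block[where G = G] r s indep large G size) (auto simp: S_def Y_def)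
    finally show ?thesis
      using sub finite_subset by fastforce
  qed auto
  have "{n. n < N \<and> few_mixed s w (l * r ^ n div s ^ K)} \<subseteq> {..<n1} \<union> (\<Union>b\<le>N div H. S b)"
    using div_le_mono[OF less_imp_le, of _ N H] by (auto simp: S_def)
  then have "card {n. n < N \<and> few_mixed s w (l * r ^ n div s ^ K)}
      \<le> card ({..<n1} \<union> (\<Union>b\<le>N div H. S b))"
    using S by (intro card_mono) auto
  also have "\<dots> \<le> card {..<n1} + card (\<Union>b\<le>N div H. S b)"
    by (rule card_Un_le)
  also have "card (\<Union>b\<le>N div H. S b) \<le> (\<Sum>b\<le>N div H. card (S b))"
    by (intro card_UN_le) auto
  also have "\<dots> \<le> (\<Sum>b\<le>N div H. B)"
    using S by (intro sum_mono) auto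
  finally show ?thesis
    by (simp add: B_def)
qed

section \<open>Bounding the cosine products\<close>

text \<open>
  The function \<open>\<lambda>x. cos x * exp (x\<^sup>2 / 2)\<close> is decreasing on \<open>[0, pi / 2]\<close> since \<open>x * cos x \<le> sin x\<close>
  there.
\<close>

lemma cos_le_exp:
  fixes x :: real
  assumes "0 \<le> x" "x \<le> pi / 2"
  shows "cos x \<le> exp (- (x\<^sup>2 / 2))"
proof -
  have tan: "y * cos y \<le> sin y" if "0 \<le> y" "y \<le> pi / 2" for y :: real
  proof -
    have "sin 0 - 0 * cos 0 \<le> sin y - y * cos y"
    proof (rule DERIV_nonneg_imp_nondecreasing[OF that(1)])
      fix t assume t: "0 \<le> t" "t \<le> y"
      have "((\<lambda>x. sin x - x * cos x) has_real_derivative t * sin t) (at t)"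
        by (auto intro!: derivative_eq_intros)
      moreover have "0 \<le> t * sin t"
        using t that by (intro mult_nonneg_nonneg sin_ge_zero) auto
      ultimately show "\<exists>d. ((\<lambda>x. sin x - x * cos x) has_real_derivative d) (at t) \<and> 0 \<le> d"
        by blast
    qed
    then show ?thesis by simp
  qed
  have "cos x * exp (x\<^sup>2 / 2) \<le> cos 0 * exp (0\<^sup>2 / 2)"
  proof (rule DERIV_nonpos_imp_nonincreasing[OF assms(1)])
    fix t assume t: "0 \<le> t" "t \<le> x"
    have "((\<lambda>x. cos x * exp (x\<^sup>2 / 2)) has_real_derivative
        (t * cos t - sin t) * exp (t\<^sup>2 / 2)) (at t)"
      by (auto intro!: derivative_eq_intros simp: algebra_simps)
    moreover have "(t * cos t - sin t) * exp (t\<^sup>2 / 2) \<le> 0"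
      using tan[of t] t assms by (simp add: mult_le_0_iff)
    ultimately show "\<exists>d. ((\<lambda>x. cos x * exp (x\<^sup>2 / 2)) has_real_derivative d) (at t) \<and> d \<le> 0"
      by blast
  qed
  then show ?thesis
    by (simp add: exp_minus field_simps)
qed

text \<open>
  Subtracting a multiple of \<open>pi\<close> leaves an angle between \<open>pi / s\<^sup>2\<close> and \<open>pi - pi / s\<^sup>2\<close>.
\<close>

lemma abs_cos_le_of_mixed:
  fixes s Y K i :: nat
  assumes s: "s \<ge> 2" and mixed: "mixed s (Y div s ^ K) i"
  shows "\<bar>cos (pi * real Y / real s ^ (K + i + 2))\<bar> \<le> cos (pi / (real s)\<^sup>2)"
proof -
  define P where "P = s ^ (K + i)"
  define Q where "Q = s\<^sup>2"
  define V where "V = Y div P"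
  define \<tau> where "\<tau> = real Y / real P - real V"
  define \<theta> where "\<theta> = pi * (real (V mod Q) + \<tau>) / real Q"
  have P: "P > 0" and Q: "Q \<ge> 4"
    using s power_mono[of 2 s 2] by (simp_all add: P_def Q_def)
  have "V mod Q \<noteq> 0" "V mod Q \<noteq> Q - 1"
    using mixed by (simp_all add: mixed_def V_def P_def Q_def power_add div_mult2_eq)
  moreover have "V mod Q < Q"
    using Q by simp
  ultimately have v: "1 \<le> real (V mod Q)" "real (V mod Q) \<le> real Q - 2"
    by linarith+
  have \<tau>: "0 \<le> \<tau>" "\<tau> \<le> 1"
  proof -
    have "V * P \<le> Y" "Y \<le> (V + 1) * P"
      using P by (simp_all add: V_def dividend_less_div_times less_imp_le)
    then have "real (V * P) \<le> real Y" "real Y \<le> real ((V + 1) * P)"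
      by (simp_all only: of_nat_le_iff)
    then show "0 \<le> \<tau>" "\<tau> \<le> 1"
      using P by (simp_all add: \<tau>_def field_simps)
  qed
  have \<theta>: "pi / real Q \<le> \<theta>" "\<theta> \<le> pi - pi / real Q"
  proof -
    have "pi * 1 / real Q \<le> \<theta>"
      unfolding \<theta>_def using v \<tau> Q by (intro divide_right_mono mult_left_mono) auto
    then show "pi / real Q \<le> \<theta>" by simp
    have "\<theta> \<le> pi * (real Q - 1) / real Q"
      unfolding \<theta>_def using v \<tau> Q by (intro divide_right_mono mult_left_mono) auto
    also have "\<dots> = pi - pi / real Q"
      using Q by (simp add: field_simps)
    finally show "\<theta> \<le> pi - pi / real Q" .
  qed
  have pQ: "0 \<le> pi / real Q" "pi / real Q \<le> pi"
    using Q by (simp_all add: field_simps)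
  have "pi * real Y / real s ^ (K + i + 2) = pi * (real Y / real P) / real Q"
    by (simp add: P_def Q_def power_add power2_eq_square)
  also have "\<dots> = pi * (real V + \<tau>) / real Q"
    by (simp add: \<tau>_def)
  also have "real V = real (V div Q) * real Q + real (V mod Q)"
    by (metis div_mult_mod_eq of_nat_add of_nat_mult)
  also have "pi * (real (V div Q) * real Q + real (V mod Q) + \<tau>) / real Q
      = \<theta> + real (V div Q) * pi"
    using Q by (simp add: \<theta>_def field_simps)
  finally have "\<bar>cos (pi * real Y / real s ^ (K + i + 2))\<bar> = \<bar>cos \<theta>\<bar>"
    by (simp add: cos_add abs_mult power_abs)
  also have "\<dots> \<le> cos (pi / real Q)"
  proof (rule abs_leI)
    show "cos \<theta> \<le> cos (pi / real Q)"
      using \<theta> pQ by (intro cos_monotone_0_pi_le) linarith+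
    have "cos (pi - pi / real Q) \<le> cos \<theta>"
      using \<theta> pQ by (intro cos_monotone_0_pi_le) linarith+
    then show "- cos \<theta> \<le> cos (pi / real Q)"
      by (simp add: cos_diff)
  qed
  finally show ?thesis
    by (simp add: Q_def)
qed

lemma cos_prod_le_one:
  assumes "s > 1"
  shows "cos_prod r s K l n \<le> 1"
proof (rule LIMSEQ_le_const2)
  show "(\<lambda>m. \<Prod>j\<le>m. \<bar>cos (pi * real r ^ n * real l / real s ^ (K + 1 + j))\<bar>)
      \<longlonglongrightarrow> cos_prod r s K l n"
    unfolding cos_prod_def by (intro convergent_prod_LIMSEQ convergent_cos_prod assms)
qed (auto intro!: prod_le_1)

lemma cos_prod_le_of_mixed:
  fixes r s K l n w :: nat
  assumes s: "s > 1" and many: "\<not> few_mixed s w (l * r ^ n div s ^ K)"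
  shows "cos_prod r s K l n \<le> exp (- (pi\<^sup>2 / 2 * (1 / real s ^ 4))) ^ (w + 1)"
proof -
  define f where "f j = \<bar>cos (pi * real r ^ n * real l / real s ^ (K + 1 + j))\<bar>" for j
  define c where "c = cos (pi / (real s)\<^sup>2)"
  obtain q where q: "w + 1 \<le> card {k. k < q \<and> mixed s (l * r ^ n div s ^ K) k}"
    using many by (auto simp: few_mixed_def not_le Suc_le_eq)
  \<comment> \<open>the digit pair at position \<open>k\<close> above \<open>K\<close> governs the divisor \<open>s ^ (K + k + 2)\<close>, the factor of index \<open>k + 1\<close>\<close>
  define A where "A = Suc ` {k. k < q \<and> mixed s (l * r ^ n div s ^ K) k}"
  have f01: "0 \<le> f j" "f j \<le> 1" for j
    by (simp_all add: f_def)
  have s4: "(real s)\<^sup>2 \<ge> 4"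
    using s power_mono[of 2 "real s" 2] by simp
  have angle: "0 \<le> pi / (real s)\<^sup>2" "pi / (real s)\<^sup>2 \<le> pi / 2"
  proof -
    show "pi / (real s)\<^sup>2 \<le> pi / 2"
      by (rule divide_left_mono) (use s s4 in auto)
  qed simp
  have c: "0 \<le> c" "c \<le> 1" "c \<le> exp (- (pi\<^sup>2 / 2 * (1 / real s ^ 4)))"
  proof -
    show "0 \<le> c"
      unfolding c_def using angle by (intro cos_ge_zero) linarith+
    have "c \<le> exp (- ((pi / (real s)\<^sup>2)\<^sup>2 / 2))"
      unfolding c_def using angle by (rule cos_le_exp)
    also have "(pi / (real s)\<^sup>2)\<^sup>2 / 2 = pi\<^sup>2 / 2 * (1 / real s ^ 4)"
      by (simp add: power_divide)
    finally show "c \<le> exp (- (pi\<^sup>2 / 2 * (1 / real s ^ 4)))" .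
  qed (simp add: c_def)
  have fc: "f j \<le> c" if "j \<in> A" for j
  proof -
    obtain k where k: "j = Suc k" "mixed s (l * r ^ n div s ^ K) k"
      using \<open>j \<in> A\<close> by (auto simp: A_def)
    have "f j = \<bar>cos (pi * real (l * r ^ n) / real s ^ (K + k + 2))\<bar>"
      by (simp add: f_def k mult_ac)
    also have "\<dots> \<le> c"
      unfolding c_def using s k by (intro abs_cos_le_of_mixed) auto
    finally show ?thesis .
  qed
  have "(\<Prod>j\<le>m. f j) \<le> c ^ (w + 1)" if "m \<ge> q" for m
  proof -
    have "A \<subseteq> {..m}"
      using that by (auto simp: A_def)
    then have "(\<Prod>j\<le>m. f j) = (\<Prod>j\<in>{..m} - A. f j) * (\<Prod>j\<in>A. f j)"
      by (intro prod.subset_diff) auto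
    also have "\<dots> \<le> 1 * (\<Prod>j\<in>A. c)"
      using f01 fc c by (intro mult_mono prod_le_1 prod_mono prod_nonneg) auto
    also have "\<dots> = c ^ card A"
      by simp
    also have "\<dots> \<le> c ^ (w + 1)"
      using q c by (intro power_decreasing) (auto simp: A_def card_image)
    finally show ?thesis .
  qed
  moreover have "(\<lambda>m. \<Prod>j\<le>m. f j) \<longlonglongrightarrow> cos_prod r s K l n"
    unfolding cos_prod_def f_def by (intro convergent_prod_LIMSEQ convergent_cos_prod s)
  ultimately have "cos_prod r s K l n \<le> c ^ (w + 1)"
    by (intro LIMSEQ_le_const2) blast+
  also have "\<dots> \<le> exp (- (pi\<^sup>2 / 2 * (1 / real s ^ 4))) ^ (w + 1)"
    using c by (intro power_mono)
  finally show ?thesis .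
qed

section \<open>The quantitative count\<close>

text \<open>
  The number of mixed pairs, relative to \<open>ln N\<close>, that makes the cosine product at most
  \<open>N powr (- a20 s)\<close>.
\<close>

definition mixed_density :: "nat \<Rightarrow> real" where
  "mixed_density s = 1 / 6 * (7 / 1000) * (1 / ln (real s)) * (1 / ln (real s) - 1 / real s)"

lemma a20_eq: "a20 s = pi\<^sup>2 / 2 * (1 / real s ^ 4) * mixed_density s"
  by (simp only: a20_def mixed_density_def mult_ac)

text \<open>
  The third bound says that \<open>(100 * s) ^ w\<close> is at most \<open>N powr (1 / 60)\<close> when
  \<open>w \<le> mixed_density s * ln N\<close>: it controls the number of digit strings with \<open>w\<close> mixed pairs.
\<close>

lemma mixed_density_bounds:
  assumes "s > 1"
  shows "0 < mixed_density s" "mixed_density s \<le> 1 / 300"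
    "mixed_density s * (5 + ln (real s)) \<le> 1 / 60"
proof -
  define y where "y = 1 / ln (real s)"
  have ln: "2 / 3 \<le> ln (real s)"
  proof -
    have "ln 2 \<le> ln (real s)"
      using assms by simp
    then show ?thesis
      using ln2_ge_two_thirds by linarith
  qed
  then have y: "0 < y" "y \<le> 3 / 2" "y * ln (real s) = 1"
    by (simp_all add: y_def field_simps)
  show pos: "0 < mixed_density s"
  proof (rule zero_less_mult_pos)
    show "0 < pi\<^sup>2 / 2 * (1 / real s ^ 4) * mixed_density s"
      using a20_pos[OF assms] by (simp only: a20_eq)
    show "0 < pi\<^sup>2 / 2 * (1 / real s ^ 4)"
      using assms by simp
  qed
  have le: "mixed_density s \<le> 7 / 6000 * (y * y)"
    using y assms by (simp add: mixed_density_def y_def[symmetric] mult_left_mono)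
  have "y * y \<le> 3 / 2 * (3 / 2)"
    using y by (intro mult_mono) auto
  with le show "mixed_density s \<le> 1 / 300"
    by simp
  have "mixed_density s * (5 + ln (real s)) \<le> 7 / 6000 * (y * y) * (5 + ln (real s))"
    using le ln by (intro mult_right_mono) auto
  also have "\<dots> = 7 / 6000 * (5 * (y * y) + y * (y * ln (real s)))"
    by (simp add: algebra_simps)
  also have "\<dots> \<le> 1 / 60"
    using \<open>y * y \<le> 3 / 2 * (3 / 2)\<close> y by simp
  finally show "mixed_density s * (5 + ln (real s)) \<le> 1 / 60" .
qed

text \<open>
  From \<open>2 ^ multiplicity p y \<le> y\<close> the valuation is at most \<open>ln y / ln 2\<close>, and \<open>ln 2 \<ge> 2 / 3\<close>.
\<close>

lemma power_multiplicity_le_exp: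
  fixes p x y :: nat and m :: real
  assumes "prime p" "x > 1" "y > 1" "real x \<le> m" "real y \<le> m"
  shows "real (x ^ multiplicity p y) \<le> exp (3 / 2 * (ln m)\<^sup>2)"
proof -
  define d where "d = multiplicity p y"
  have "2 ^ d \<le> p ^ d"
    using assms prime_ge_2_nat by (intro power_mono) auto
  also have "p ^ d \<le> y"
    using assms by (intro dvd_imp_le) (auto simp: d_def multiplicity_dvd)
  finally have "real (2 ^ d) \<le> real y"
    by (simp only: of_nat_le_iff)
  then have "ln (2 ^ d) \<le> ln (real y)"
    using assms by (intro ln_mono) auto
  then have "real d * ln 2 \<le> ln (real y)"
    by (simp add: ln_realpow)
  moreover have "real d * (2 / 3) \<le> real d * ln 2"
    using ln2_ge_two_thirds by (intro mult_left_mono) auto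
  moreover have "ln (real y) \<le> ln m"
    using assms by (intro ln_mono) auto
  ultimately have d: "real d \<le> 3 / 2 * ln m"
    by linarith
  have "real (x ^ d) = exp (real d * ln (real x))"
    using assms by (simp add: exp_of_nat_mult)
  also have "real d * ln (real x) \<le> (3 / 2 * ln m) * ln m"
    using d assms by (intro mult_mono ln_mono) auto
  finally show ?thesis
    by (simp add: d_def power2_eq_square mult.assoc)
qed

text \<open>
  The weight \<open>x = 1 / (100 * s)\<close> balances the two factors of the generating function bound: the
  positions cost \<open>(1 + 1 / 100) ^ q\<close>, about \<open>exp (L / 50)\<close>, and the mixed pairs cost \<open>(100 * s) ^ w\<close>.
\<close>

lemma card_few_mixed_residues_le_exp:
  fixes s w q :: nat and L :: real
  assumes s: "s > 1" and w: "real w \<le> mixed_density s * L" and q: "real q \<le> 2 * L + 1"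
    and L: "L \<ge> 1000" and lns: "ln (real s) \<le> L / 1000"
  shows "real (card ((\<lambda>z. z mod s ^ (q + 1)) ` {z. few_mixed s w z})) \<le> exp (L / 25)"
proof -
  have ln100: "ln (100 :: real) \<le> 5"
  proof -
    have "(100 :: real) \<le> (13 / 8) ^ 10"
      by (simp add: power_divide)
    also have "\<dots> \<le> exp (1 / 2) ^ 10"
      using exp_lower_Taylor_quadratic[of "1 / 2"] by (intro power_mono) (auto simp: power2_eq_square)
    also have "\<dots> = exp 5"
      by (simp flip: exp_of_nat_mult)
    finally have "ln (100 :: real) \<le> ln (exp 5)"
      by (intro ln_mono) auto
    then show ?thesis by simp
  qed
  have "real (card ((\<lambda>z. z mod s ^ (q + 1)) ` {z. few_mixed s w z}))
      \<le> real s * (1 + real s * (1 / (100 * real s))) ^ q / (1 / (100 * real s)) ^ w"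
    using s by (intro card_few_mixed_residues) auto
  also have "\<dots> = real s * (1 + 1 / 100) ^ q * (100 * real s) ^ w"
    using s by (simp add: power_one_over)
  also have "\<dots> \<le> exp (L / 1000) * exp (1 / 100 * (2 * L + 1)) * exp (L / 60)"
  proof (intro mult_mono)
    have "real s = exp (ln (real s))"
      using s by simp
    also have "\<dots> \<le> exp (L / 1000)"
      using lns by simp
    finally show "real s \<le> exp (L / 1000)" .
    have "(1 + 1 / 100 :: real) ^ q \<le> exp (1 / 100) ^ q"
      by (intro power_mono exp_ge_add_one_self) auto
    also have "\<dots> = exp (1 / 100 * real q)"
      by (simp add: exp_of_nat_mult[symmetric] mult.commute)
    also have "\<dots> \<le> exp (1 / 100 * (2 * L + 1))"
      using q by simp
    finally show "(1 + 1 / 100 :: real) ^ q \<le> exp (1 / 100 * (2 * L + 1))" .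
    have ln_pos: "0 \<le> ln (real s)"
      using s by simp
    have "(100 * real s) ^ w = exp (real w * ln (100 * real s))"
      using s by (simp add: exp_of_nat_mult)
    also have "real w * ln (100 * real s) \<le> (mixed_density s * L) * (5 + ln (real s))"
      using w s ln100 ln_pos L by (intro mult_mono) (auto simp: ln_mult)
    also have "\<dots> = (mixed_density s * (5 + ln (real s))) * L"
      by simp
    also have "\<dots> \<le> 1 / 60 * L"
      using mixed_density_bounds[OF s] L by (intro mult_right_mono) auto
    finally show "(100 * real s) ^ w \<le> exp (L / 60)"
      by simp
  qed auto
  also have "\<dots> = exp (L / 1000 + 1 / 100 * (2 * L + 1) + L / 60)"
    by (simp only: exp_add)
  also have "\<dots> \<le> exp (L / 25)"
  proof (rule exp_le_cancel_iff[THEN iffD2])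
    show "L / 1000 + 1 / 100 * (2 * L + 1) + L / 60 \<le> L / 25"
      using L by (simp add: field_simps)
  qed
  finally show ?thesis .
qed

text \<open>
  Every factor other than \<open>exp (L / 2)\<close> is at most a small power of \<open>exp L = N\<close>. Blocks have length
  about \<open>exp (L / 2)\<close>, so the number of discarded initial indices and the number of blocks both have
  that order, up to such powers. The lower bound on \<open>L\<close> is what makes the gap constant of
  \<open>orbit_residue_gap\<close>, of size at most \<open>exp (3 * m * (ln m)\<^sup>2)\<close>, a small power of \<open>N\<close>.
\<close>

lemma card_few_mixed_iterates_le:
  fixes r s K l N w :: nat and L m :: real
  assumes r: "r > 1" and s: "s > 1" and indep: "\<And>i j. i > 0 \<Longrightarrow> r ^ i \<noteq> s ^ j"
    and l: "s ^ K \<le> l" and N: "real N = exp L"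
    and m: "real r \<le> m" "real s \<le> m" and lnm: "ln m \<ge> 1"
    and L: "L \<ge> 3456 * (m * (ln m)\<^sup>2)" "L \<ge> 1000"
    and w: "real w \<le> mixed_density s * L"
  shows "real (card {n. n < N \<and> few_mixed s w (l * r ^ n div s ^ K)}) \<le> exp (13 / 20 * L)"
proof -
  define q where "q = nat \<lceil>2 * L\<rceil>"
  define H where "H = nat \<lfloor>exp (L / 2)\<rfloor>"
  \<comment> \<open>\<open>r \<le> s ^ r\<close> gives \<open>r ^ H \<le> s ^ G\<close>, and \<open>s \<le> r ^ s\<close> gives \<open>s ^ (w * G) \<le> r ^ n1\<close>\<close>
  define G where "G = H * r"
  define n1 where "n1 = w * G * s"
  define R where "R = card ((\<lambda>z. z mod s ^ (q + 1)) ` {z. few_mixed s w z})"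
  have q: "2 * L \<le> real q" "real q \<le> 2 * L + 1"
    using L by (simp_all add: q_def)
  have H: "real H \<le> exp (L / 2)" "exp (L / 2) \<le> 2 * real H" "H > 0"
  proof -
    have big: "exp (L / 2) \<ge> 2"
      using exp_ge_add_one_self[of "L / 2"] L by linarith
    have "exp (L / 2) - 1 \<le> real H"
      unfolding H_def using big by linarith
    with big show "exp (L / 2) \<le> 2 * real H" "H > 0"
      by linarith+
    show "real H \<le> exp (L / 2)"
      by (simp add: H_def)
  qed
  have m2: "m \<ge> 2"
    using m s by linarith
  have mln: "m * (ln m)\<^sup>2 \<ge> m" "m * (ln m)\<^sup>2 \<ge> ln m"
  proof -
    have "1 * ln m \<le> ln m * ln m"
      using lnm by (intro mult_right_mono) auto
    then have sq: "ln m \<le> (ln m)\<^sup>2"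
      by (simp add: power2_eq_square)
    then have "m * 1 \<le> m * (ln m)\<^sup>2" "1 * (ln m)\<^sup>2 \<le> m * (ln m)\<^sup>2"
      using lnm m2 by (intro mult_left_mono mult_right_mono; linarith)+
    then show "m * (ln m)\<^sup>2 \<ge> m" "m * (ln m)\<^sup>2 \<ge> ln m"
      using sq by linarith+
  qed
  have small: "real x \<le> exp (L / 1000)" "ln (real x) \<le> L / 1000" if "1 < x" "real x \<le> m" for x :: nat
  proof -
    have "ln (real x) \<le> ln m"
      using that by (intro ln_mono) auto
    then show "ln (real x) \<le> L / 1000"
      using mln L by linarith
    then have "exp (ln (real x)) \<le> exp (L / 1000)"
      by simp
    then show "real x \<le> exp (L / 1000)"
      using that by simp
  qed
  have large: "max (r ^ multiplicity p s) (s ^ multiplicity p r) ^ (2 * (p - 1)) * H \<le> 2 ^ (q + 1)"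
    if p: "prime p" "p dvd s" for p
  proof -
    let ?X = "max (r ^ multiplicity p s) (s ^ multiplicity p r)"
    have X: "real ?X \<le> exp (3 / 2 * (ln m)\<^sup>2)"
      using power_multiplicity_le_exp[OF p(1) r s m] power_multiplicity_le_exp[OF p(1) s r m(2,1)]
      by (simp add: of_nat_max)
    have "p \<le> s"
      using p s by (intro dvd_imp_le) auto
    then have p2: "real (2 * (p - 1)) \<le> 2 * m"
      using m by linarith
    have "real ?X ^ (2 * (p - 1)) \<le> exp (3 / 2 * (ln m)\<^sup>2) ^ (2 * (p - 1))"
      using X by (intro power_mono) auto
    also have "\<dots> = exp (real (2 * (p - 1)) * (3 / 2 * (ln m)\<^sup>2))"
      by (rule exp_of_nat_mult[symmetric])
    also have "\<dots> \<le> exp (2 * m * (3 / 2 * (ln m)\<^sup>2))"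
      using p2 by (intro exp_le_cancel_iff[THEN iffD2] mult_right_mono) auto
    also have "\<dots> \<le> exp (L / 1000)"
      using L by simp
    finally have "real ?X ^ (2 * (p - 1)) * real H \<le> exp (L / 1000) * exp (L / 2)"
      using H by (intro mult_mono) auto
    also have "\<dots> \<le> exp (real q * ln 2)"
    proof -
      have "2 * L * (2 / 3) \<le> real q * ln 2"
        using q ln2_ge_two_thirds L by (intro mult_mono) auto
      then show ?thesis
        using L by (simp flip: exp_add)
    qed
    also have "\<dots> = 2 ^ q"
      by (simp add: exp_of_nat_mult)
    finally have "real (?X ^ (2 * (p - 1)) * H) \<le> real (2 ^ q)"
      by simp
    then have "?X ^ (2 * (p - 1)) * H \<le> 2 ^ q"
      by (simp only: of_nat_le_iff)
    also have "\<dots> \<le> 2 ^ (q + 1)"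
      by simp
    finally show ?thesis .
  qed
  have less_power: "x \<le> y ^ x" if "y > 1" for x y :: nat
  proof -
    have "x < 2 ^ x" by simp
    also have "\<dots> \<le> y ^ x"
      using that by (intro power_mono) auto
    finally show ?thesis by simp
  qed
  have "card {n. n < N \<and> few_mixed s w (l * r ^ n div s ^ K)}
      \<le> n1 + (N div H + 1) * (2 * s * R)"
    unfolding R_def
  proof (rule card_few_mixed_total[OF r s indep large])
    show "G > 0"
      using H r by (simp add: G_def)
    have "r ^ H \<le> (s ^ r) ^ H"
      using less_power[OF s] by (rule power_mono) simp
    then show "r ^ H \<le> s ^ G"
      by (simp add: G_def mult.commute flip: power_mult)
    have "s ^ (w * G) \<le> (r ^ s) ^ (w * G)"
      using less_power[OF r] by (rule power_mono) simp
    then show "s ^ (w * G) \<le> r ^ n1"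
      by (simp add: n1_def mult.commute flip: power_mult)
  qed (use H l in auto)
  then have "real (card {n. n < N \<and> few_mixed s w (l * r ^ n div s ^ K)})
      \<le> real (n1 + (N div H + 1) * (2 * s * R))"
    by (simp only: of_nat_le_iff)
  also have "\<dots> = real n1 + (real (N div H) + 1) * (2 * real s * real R)"
    by (simp add: algebra_simps)
  also have "\<dots> \<le> exp (L / 10) * (exp (L / 2) * exp (L / 1000)) * exp (L / 1000)
      + (3 * exp (L / 2)) * (2 * exp (L / 1000) * exp (L / 25))"
  proof (intro add_mono mult_mono)
    have "real w \<le> 1 / 300 * L"
      using w mixed_density_bounds(2)[OF s] L mult_right_mono[of "mixed_density s" "1 / 300" L]
      by linarith
    also have "\<dots> \<le> exp (L / 10)"
      using exp_ge_add_one_self[of "L / 10"] L by linarith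
    finally have "real w \<le> exp (L / 10)" .
    then show "real n1 \<le> exp (L / 10) * (exp (L / 2) * exp (L / 1000)) * exp (L / 1000)"
      unfolding n1_def G_def of_nat_mult using H small[OF r m(1)] small[OF s m(2)]
      by (intro mult_mono) auto
    have "real (N div H) \<le> real N / real H"
      by (rule of_nat_div_le_of_nat)
    also have "\<dots> \<le> 2 * exp (L / 2)"
    proof -
      have "exp L = exp (L / 2) * exp (L / 2)"
        by (simp flip: exp_add)
      also have "\<dots> \<le> exp (L / 2) * (2 * real H)"
        using H by (intro mult_left_mono) auto
      finally show ?thesis
        using H by (simp add: N field_simps)
    qed
    finally show "real (N div H) + 1 \<le> 3 * exp (L / 2)"
      using exp_ge_add_one_self[of "L / 2"] L by linarith
    show "real s \<le> exp (L / 1000)"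
      using small s m by auto
    show "real R \<le> exp (L / 25)"
      unfolding R_def using s w q L small[OF s m(2)] by (intro card_few_mixed_residues_le_exp) auto
  qed auto
  also have "\<dots> = exp (301 / 500 * L) + 6 * exp (541 / 1000 * L)"
    by (simp flip: exp_add)
  also have "\<dots> \<le> 7 * exp (301 / 500 * L)"
    using L by simp
  also have "\<dots> \<le> exp (6 / 125 * L) * exp (301 / 500 * L)"
  proof (rule mult_right_mono)
    show "7 \<le> exp (6 / 125 * L)"
      using exp_ge_add_one_self[of "6 / 125 * L"] L by linarith
  qed simp
  also have "\<dots> = exp (13 / 20 * L)"
    by (simp flip: exp_add)
  finally show ?thesis .
qed

section \<open>The exponential sum\<close>

lemma power_neq_of_not_mult_dependent:
  assumes "\<not> mult_dependent r s" "r > 1" "s > 1" "i > 0"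
  shows "r ^ i \<noteq> s ^ j"
proof
  assume "r ^ i = s ^ j"
  then have "real r ^ i = real s ^ j"
    by (metis of_nat_power)
  then have "(real r powr real i) powr (1 / real i) = (real s powr real j) powr (1 / real i)"
    using assms by (simp add: powr_realpow)
  then have "real r = real s powr (real j / real i)"
    using assms by (simp add: powr_powr)
  moreover have "real j / real i \<in> \<rat>"
    by simp
  ultimately show False
    using assms(1) unfolding mult_dependent_def by blast
qed

theorem lemma3p1:
  fixes r s K l N :: nat
  assumes "r > 1" and "s > 1"
    and "\<not> mult_dependent r s"
    and "K > 0" and "l > 0"
    and "l \<ge> s ^ K"
    and "real N \<ge> N0 r s"
  shows "(\<Sum>n = 0..<N. cos_prod r s K l n) \<le> 2 * real N powr (1 - a20 s)"
proof -
  define m where "m = real (max r s)"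
  define L where "L = ln (real N)"
  \<comment> \<open>indices with more than \<open>w\<close> mixed pairs have at least \<open>mixed_density s * L\<close> of them\<close>
  define w where "w = nat \<lfloor>mixed_density s * L\<rfloor>"
  define A where "A = {n. n < N \<and> few_mixed s w (l * r ^ n div s ^ K)}"
  note indep = power_neq_of_not_mult_dependent[OF assms(3,1,2)]
  have "r \<noteq> s"
    using indep[of 1 1] by simp
  then have m3: "m \<ge> 3"
    using assms(1,2) by (auto simp: m_def)
  then have lnm: "ln m \<ge> 1"
    using ln_mono[of "exp 1" m] exp_le by simp
  have "0 < N0 r s"
    by (simp add: N0_def Let_def)
  with assms(7) have N: "real N = exp L" "real N > 0"
    by (simp_all add: L_def)
  have "ln (N0 r s) \<le> L"
    unfolding L_def using assms(7) \<open>0 < N0 r s\<close> by (intro ln_mono) auto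
  then have "3456 * (m * ln m ^ 4) + 2304 * ln m ^ 3 + 288 * (ln m)\<^sup>2 \<le> L"
    by (simp add: N0_def Let_def m_def)
  moreover have "0 \<le> ln m ^ 3" "0 \<le> ln m ^ 2"
    using lnm by simp_all
  moreover have "m * (ln m)\<^sup>2 \<le> m * ln m ^ 4"
    using lnm m3 by (intro mult_left_mono power_increasing) auto
  ultimately have L: "3456 * (m * (ln m)\<^sup>2) \<le> L"
    by linarith
  have "m * 1 \<le> m * (ln m)\<^sup>2"
    using lnm m3 by (intro mult_left_mono) auto
  with L m3 have L1000: "L \<ge> 1000"
    by linarith
  have md: "0 < mixed_density s" "mixed_density s \<le> 1 / 300"
    using mixed_density_bounds[OF assms(2)] by auto
  have w: "real w \<le> mixed_density s * L" "mixed_density s * L \<le> real (w + 1)"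
    using md L1000 by (simp_all add: w_def) linarith
  have a20_le: "a20 s \<le> 7 / 20"
  proof -
    have "pi\<^sup>2 \<le> 4\<^sup>2"
      using pi_less_4 by (intro power_mono) auto
    moreover have "1 / real s ^ 4 \<le> 1"
      using assms(2) by simp
    ultimately have "pi\<^sup>2 / 2 * (1 / real s ^ 4) * mixed_density s \<le> 8 * 1 * (1 / 300)"
      using md by (intro mult_mono) auto
    then have "a20 s \<le> 8 * 1 * (1 / 300)"
      by (simp only: a20_eq)
    then show ?thesis by simp
  qed
  have target: "real N powr (1 - a20 s) = exp ((1 - a20 s) * L)"
    using N by (simp add: powr_def L_def)
  have "cos_prod r s K l n \<le> of_bool (n \<in> A) + exp (- (a20 s * L))" if "n < N" for n
  proof (cases "n \<in> A")
    case True
    then show ?thesis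
      using cos_prod_le_one[OF assms(2), of r K l n] by (simp add: add_increasing2)
  next
    case False
    then have "\<not> few_mixed s w (l * r ^ n div s ^ K)"
      using that by (simp add: A_def)
    then have "cos_prod r s K l n \<le> exp (- (pi\<^sup>2 / 2 * (1 / real s ^ 4))) ^ (w + 1)"
      by (rule cos_prod_le_of_mixed[OF assms(2)])
    also have "\<dots> = exp (- (pi\<^sup>2 / 2 * (1 / real s ^ 4) * real (w + 1)))"
      by (simp only: exp_of_nat_mult[symmetric]) (simp add: algebra_simps)
    also have "\<dots> \<le> exp (- (pi\<^sup>2 / 2 * (1 / real s ^ 4) * (mixed_density s * L)))"
      using w(2) by (intro exp_le_cancel_iff[THEN iffD2] le_imp_neg_le mult_left_mono) auto
    also have "\<dots> = exp (- (a20 s * L))"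
      by (simp add: a20_eq mult.assoc)
    finally show ?thesis
      using False by simp
  qed
  then have "(\<Sum>n = 0..<N. cos_prod r s K l n)
      \<le> (\<Sum>n = 0..<N. of_bool (n \<in> A) + exp (- (a20 s * L)))"
    by (intro sum_mono) auto
  also have "\<dots> = real (card A) + real N * exp (- (a20 s * L))"
  proof -
    have "{0..<N} \<inter> A = A"
      by (auto simp: A_def)
    then show ?thesis
      by (simp add: sum.distrib sum_of_bool_eq)
  qed
  also have "real (card A) \<le> exp (13 / 20 * L)"
    unfolding A_def
    by (rule card_few_mixed_iterates_le[OF assms(1,2) indep assms(6) N(1) _ _ lnm L L1000 w(1)])
      (auto simp: m_def)
  also have "exp (13 / 20 * L) \<le> exp ((1 - a20 s) * L)"
    using a20_le L1000 by (intro exp_le_cancel_iff[THEN iffD2] mult_right_mono) auto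
  also have "real N * exp (- (a20 s * L)) = exp ((1 - a20 s) * L)"
    by (simp add: N(1) algebra_simps flip: exp_add)
  finally show ?thesis
    by (simp add: target)
qed

end
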